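(* If 2-edge-SAT is solvable in $O(2^{cn})$ time for some $c>0$ in the extension oracle model (with $n$ the number of variables), then Subset Sum is solvable in $O(2^{(c+\varepsilon)n})$ time for every $\varepsilon>0$ (with $n$ the number of input integers).
   Context: 2-edge-SAT is $\mathrm{SAT}(\mathrm{Inv}(e_2))$: given Boolean variables and constraints $R(v_1,\dots,v_r)$, each $R\subseteq\{0,1\}^r$ preserved by the partial 2-edge operation $e_2$, decide satisfiability. Here $e_2$ is the ternary Boolean partial operation defined exactly on tuples $(x,x,y)$ and $(x,y,x)$ with value $y$; it is applied to tuples coordinatewise (defined iff defined in every coordinate) and $R$ is preserved if every defined application to tuples of $R$ lies in $R$. In the extension oracle model each constraint relation is given by an oracle deciding, for indices $i_1,\dots,i_{r'}$ and $t\in\{0,1\}^{r'}$, whether $t$ lies in the projection of $R$ onto these coordinates. Subset Sum: given nonnegative integers $x_1,\dots,x_n$ and a target $t$, decide whether there exist $z_1,\dots,z_n\in\{0,1\}$ with $\sum_i z_ix_i = t$. *)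

theory Defs
  imports Complex_Main "HOL-Library.Discrete_Functions"
begin

section \<open>Machine model\<close>

text \<open>
  Running time is measured on a random access machine with the logarithmic cost criterion
  (Aho, Hopcroft and Ullman), extended by an oracle instruction.  Control flow is structured,
  and the memory consists of scalar variables and indirectly addressed arrays, both named by
  natural numbers.  A program mentions only finitely many names, so interleaving the arrays
  in a single memory costs only a constant factor.
\<close>

definition bits :: "nat \<Rightarrow> nat" where
  "bits x = Suc (floor_log x)"

datatype binop = Add | Sub | Mul | Div

text \<open>
  Subtraction is truncated at zero, and division is integer division with \<open>x div 0 = 0\<close>.
\<close>

fun apply_op :: "binop \<Rightarrow> nat \<Rightarrow> nat \<Rightarrow> nat" where
  "apply_op Add x y = x + y"
| "apply_op Sub x y = x - y"
| "apply_op Mul x y = x * y"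
| "apply_op Div x y = x div y"

datatype expr =
    Const nat
  | Var nat
  | Arr nat expr
  | Op binop expr expr

record state =
  var :: "nat \<Rightarrow> nat"
  arr :: "nat \<Rightarrow> nat \<Rightarrow> nat"

fun eval :: "expr \<Rightarrow> state \<Rightarrow> nat" where
  "eval (Const k) s = k"
| "eval (Var x) s = var s x"
| "eval (Arr a e) s = arr s a (eval e s)"
| "eval (Op f e1 e2) s = apply_op f (eval e1 s) (eval e2 s)"

fun ecost :: "expr \<Rightarrow> state \<Rightarrow> nat" where
  "ecost (Const k) s = bits k"
| "ecost (Var x) s = bits (var s x)"
| "ecost (Arr a e) s = ecost e s + bits (eval e s) + bits (arr s a (eval e s))"
| "ecost (Op f e1 e2) s = ecost e1 s + ecost e2 s + bits (eval e1 s) + bits (eval e2 s)"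

text \<open>
  \<open>Ask x j k a b\<close> puts to the oracle the query consisting of the number \<open>j\<close> and the two lists
  made up of the first \<open>k\<close> entries of the arrays \<open>a\<close> and \<open>b\<close>; the answer bit is stored in \<open>x\<close>.
\<close>

datatype prog =
    Skip
  | Assign nat expr
  | Store nat expr expr
  | Seq prog prog
  | If expr prog prog
  | While expr prog
  | Ask nat expr expr nat nat

type_synonym query_oracle = "nat \<Rightarrow> nat list \<Rightarrow> nat list \<Rightarrow> bool"

definition set_var :: "nat \<Rightarrow> nat \<Rightarrow> state \<Rightarrow> state" where
  "set_var x v s = s\<lparr>var := (var s)(x := v)\<rparr>"

definition set_arr :: "nat \<Rightarrow> nat \<Rightarrow> nat \<Rightarrow> state \<Rightarrow> state" where
  "set_arr a i v s = s\<lparr>arr := (arr s)(a := (arr s a)(i := v))\<rparr>"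

definition arr_prefix :: "state \<Rightarrow> nat \<Rightarrow> nat \<Rightarrow> nat list" where
  "arr_prefix s a k = map (arr s a) [0..<k]"

text \<open>
  \<open>exec Q p s T s'\<close>: with oracle \<open>Q\<close>, the program \<open>p\<close> started in \<open>s\<close> halts in \<open>s'\<close> after time \<open>T\<close>.
  An oracle call is charged for reading the query, but not for computing its answer.
\<close>

inductive exec :: "query_oracle \<Rightarrow> prog \<Rightarrow> state \<Rightarrow> nat \<Rightarrow> state \<Rightarrow> bool" for Q where
  Skip: "exec Q Skip s 1 s"
| Assign: "exec Q (Assign x e) s (1 + ecost e s + bits (eval e s)) (set_var x (eval e s) s)"
| Store: "exec Q (Store a e1 e2) s
    (1 + ecost e1 s + ecost e2 s + bits (eval e1 s) + bits (eval e2 s))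
    (set_arr a (eval e1 s) (eval e2 s) s)"
| Seq: "exec Q p1 s T1 s1 \<Longrightarrow> exec Q p2 s1 T2 s2 \<Longrightarrow> exec Q (Seq p1 p2) s (T1 + T2) s2"
| IfTrue: "eval e s \<noteq> 0 \<Longrightarrow> exec Q p1 s T s' \<Longrightarrow> exec Q (If e p1 p2) s (1 + ecost e s + T) s'"
| IfFalse: "eval e s = 0 \<Longrightarrow> exec Q p2 s T s' \<Longrightarrow> exec Q (If e p1 p2) s (1 + ecost e s + T) s'"
| WhileFalse: "eval e s = 0 \<Longrightarrow> exec Q (While e p) s (1 + ecost e s) s"
| WhileTrue: "eval e s \<noteq> 0 \<Longrightarrow> exec Q p s T1 s1 \<Longrightarrow> exec Q (While e p) s1 T2 s2 \<Longrightarrow>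
    exec Q (While e p) s (1 + ecost e s + T1 + T2) s2"
| Ask: "exec Q (Ask x ej ek a b) s
    (1 + ecost ej s + ecost ek s +
      (\<Sum>i<eval ek s. bits i + bits (arr s a i) + bits (arr s b i)))
    (set_var x
      (of_bool (Q (eval ej s) (arr_prefix s a (eval ek s)) (arr_prefix s b (eval ek s)))) s)"

inductive_cases exec_SkipE: "exec Q Skip s T s'"
inductive_cases exec_AssignE: "exec Q (Assign x e) s T s'"
inductive_cases exec_StoreE: "exec Q (Store a e1 e2) s T s'"
inductive_cases exec_SeqE: "exec Q (Seq p1 p2) s T s'"
inductive_cases exec_IfE: "exec Q (If e p1 p2) s T s'"
inductive_cases exec_WhileE: "exec Q (While e p) s T s'"
inductive_cases exec_AskE: "exec Q (Ask x ej ek a b) s T s'"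

lemma exec_deterministic:
  "exec Q p s T s' \<Longrightarrow> exec Q p s T' s'' \<Longrightarrow> T' = T \<and> s'' = s'"
proof (induction arbitrary: T' s'' rule: exec.induct)
  case (Skip s)
  then show ?case by (elim exec_SkipE) simp
next
  case (Assign x e s)
  then show ?case by (elim exec_AssignE) simp
next
  case (Store a e1 e2 s)
  then show ?case by (elim exec_StoreE) simp
next
  case (Seq p1 s T1 s1 p2 T2 s2)
  from Seq.prems obtain U1 u1 U2 where
    "exec Q p1 s U1 u1" "exec Q p2 u1 U2 s''" "T' = U1 + U2"
    by (rule exec_SeqE)
  with Seq.IH show ?case by metis
next
  case (IfTrue e s p1 T s' p2)
  from IfTrue.prems obtain U where "exec Q p1 s U s''" "T' = 1 + ecost e s + U"
    by (rule exec_IfE) (use IfTrue.hyps in simp_all)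
  with IfTrue.IH show ?case by metis
next
  case (IfFalse e s p2 T s' p1)
  from IfFalse.prems obtain U where "exec Q p2 s U s''" "T' = 1 + ecost e s + U"
    by (rule exec_IfE) (use IfFalse.hyps in simp_all)
  with IfFalse.IH show ?case by metis
next
  case (WhileFalse e s p)
  from WhileFalse.prems show ?case by (rule exec_WhileE) (use WhileFalse.hyps in simp_all)
next
  case (WhileTrue e s p T1 s1 T2 s2)
  from WhileTrue.prems obtain U1 u1 U2 where
    "exec Q p s U1 u1" "exec Q (While e p) u1 U2 s''" "T' = 1 + ecost e s + U1 + U2"
    by (rule exec_WhileE) (use WhileTrue.hyps in simp_all)
  with WhileTrue.IH show ?case by metis
next
  case (Ask x ej ek a b s)
  then show ?case by (elim exec_AskE) simp
qed

text \<open>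
  The input is placed in array 0 and its length in variable 0; everything else is zero.
  A halting program accepts iff variable 0 is nonzero.
\<close>

definition init_state :: "nat list \<Rightarrow> state" where
  "init_state ws =
    \<lparr>var = (\<lambda>x. if x = 0 then length ws else 0),
     arr = (\<lambda>a i. if a = 0 \<and> i < length ws then ws ! i else 0)\<rparr>"

definition accepting :: "state \<Rightarrow> bool" where
  "accepting s \<longleftrightarrow> var s 0 \<noteq> 0"

definition input_size :: "nat list \<Rightarrow> nat" where
  "input_size ws = (\<Sum>w\<leftarrow>ws. bits w)"

fun oracle_free :: "prog \<Rightarrow> bool" where
  "oracle_free (Ask x ej ek a b) \<longleftrightarrow> False"
| "oracle_free (Seq p1 p2) \<longleftrightarrow> oracle_free p1 \<and> oracle_free p2"
| "oracle_free (If e p1 p2) \<longleftrightarrow> oracle_free p1 \<and> oracle_free p2"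
| "oracle_free (While e p) \<longleftrightarrow> oracle_free p"
| "oracle_free _ \<longleftrightarrow> True"


section \<open>Parameterised decision problems with oracle-represented inputs\<close>

text \<open>
  \<open>encode\<close> is the explicit part of the input, \<open>query\<close> the part that is accessible through the
  oracle only.
\<close>

record 'i problem =
  instances :: "'i set"
  encode :: "'i \<Rightarrow> nat list"
  query :: "'i \<Rightarrow> query_oracle"
  param :: "'i \<Rightarrow> nat"
  yes :: "'i \<Rightarrow> bool"

text \<open>
  Time \<open>O(2^(cn))\<close> in the parameter \<open>n\<close> is understood, as usual for exponential-time algorithms,
  up to a factor polynomial in the size of the explicit input: \<open>n\<close> does not bound the number of
  constraints or the length of the integers, all of which an algorithm has to read.
\<close>

definition decides_in_exp_time :: "prog \<Rightarrow> 'i problem \<Rightarrow> real \<Rightarrow> bool" where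
  "decides_in_exp_time p \<Pi> c \<longleftrightarrow>
    (\<exists>C d :: nat. \<forall>I \<in> instances \<Pi>. \<exists>T s.
      exec (query \<Pi> I) p (init_state (encode \<Pi> I)) T s \<and>
      (accepting s \<longleftrightarrow> yes \<Pi> I) \<and>
      real T \<le> real C * real (input_size (encode \<Pi> I)) ^ d * 2 powr (c * real (param \<Pi> I)))"

definition solvable_in_oracle_model :: "'i problem \<Rightarrow> real \<Rightarrow> bool" where
  "solvable_in_oracle_model \<Pi> c \<longleftrightarrow> (\<exists>p. decides_in_exp_time p \<Pi> c)"

definition solvable :: "'i problem \<Rightarrow> real \<Rightarrow> bool" where
  "solvable \<Pi> c \<longleftrightarrow> (\<exists>p. oracle_free p \<and> decides_in_exp_time p \<Pi> c)"


section \<open>Boolean satisfiability over a constraint language\<close>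

text \<open>A relation carries its arity, so that empty relations of different arities are distinct.\<close>

type_synonym relation = "nat \<times> bool list set"

type_synonym partial_op3 = "bool \<Rightarrow> bool \<Rightarrow> bool \<Rightarrow> bool option"

definition is_relation :: "relation \<Rightarrow> bool" where
  "is_relation = (\<lambda>(r, R). R \<subseteq> {u. length u = r})"

definition preserves :: "partial_op3 \<Rightarrow> relation \<Rightarrow> bool" where
  "preserves f = (\<lambda>(r, R). \<forall>u\<in>R. \<forall>v\<in>R. \<forall>w\<in>R. \<forall>y.
    length y = r \<and> (\<forall>i<r. f (u ! i) (v ! i) (w ! i) = Some (y ! i)) \<longrightarrow> y \<in> R)"

definition Inv :: "partial_op3 \<Rightarrow> relation set" where
  "Inv f = {\<rho>. is_relation \<rho> \<and> preserves f \<rho>}"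

definition e2 :: partial_op3 where
  "e2 a b c = (if a = b then Some c else if a = c then Some b else None)"

text \<open>The variables of an instance are the numbers below \<open>nvars\<close>.\<close>

record sat_instance =
  nvars :: nat
  constraints :: "(relation \<times> nat list) list"

definition sat_instances :: "relation set \<Rightarrow> sat_instance set" where
  "sat_instances \<Gamma> =
    {I. \<forall>(\<rho>, vs) \<in> set (constraints I). \<rho> \<in> \<Gamma> \<and> length vs = fst \<rho> \<and> set vs \<subseteq> {..<nvars I}}"

definition satisfiable :: "sat_instance \<Rightarrow> bool" where
  "satisfiable I \<longleftrightarrow>
    (\<exists>\<alpha> :: nat \<Rightarrow> bool. \<forall>(\<rho>, vs) \<in> set (constraints I). map \<alpha> vs \<in> snd \<rho>)"

text \<open>The explicit input lists the scopes, each preceded by its length, and not the relations.\<close>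

definition encode_sat :: "sat_instance \<Rightarrow> nat list" where
  "encode_sat I = nvars I # length (constraints I) #
    concat (map (\<lambda>(\<rho>, vs). length vs # vs) (constraints I))"

definition projection :: "nat list \<Rightarrow> relation \<Rightarrow> bool list set" where
  "projection js \<rho> = (\<lambda>u. map (\<lambda>i. u ! i) js) ` snd \<rho>"

text \<open>
  Constraints and coordinates are numbered from 0, and bits are passed as the numbers 0 and 1.
  Queries with a number out of range are answered negatively.
\<close>

definition extension_oracle :: "sat_instance \<Rightarrow> query_oracle" where
  "extension_oracle I j js ts \<longleftrightarrow>
    j < length (constraints I) \<and>
    (let \<rho> = fst (constraints I ! j) in
      set js \<subseteq> {..<fst \<rho>} \<and> (\<exists>t \<in> projection js \<rho>. ts = map of_bool t))"

definition SAT :: "relation set \<Rightarrow> sat_instance problem" where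
  "SAT \<Gamma> =
    \<lparr>instances = sat_instances \<Gamma>, encode = encode_sat, query = extension_oracle,
     param = nvars, yes = satisfiable\<rparr>"

definition two_edge_SAT :: "sat_instance problem" where
  "two_edge_SAT = SAT (Inv e2)"


section \<open>Subset Sum\<close>

record subset_sum_instance =
  target :: nat
  items :: "nat list"

definition has_subset_sum :: "subset_sum_instance \<Rightarrow> bool" where
  "has_subset_sum I \<longleftrightarrow>
    (\<exists>z :: nat \<Rightarrow> nat. (\<forall>i<length (items I). z i \<in> {0, 1}) \<and>
      (\<Sum>i<length (items I). z i * items I ! i) = target I)"

text \<open>There is no oracle here; the constant one is a placeholder for oracle-free programs.\<close>

definition Subset_Sum :: "subset_sum_instance problem" where
  "Subset_Sum =
    \<lparr>instances = UNIV, encode = (\<lambda>I. target I # items I), query = (\<lambda>_ _ _ _. False),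
     param = (\<lambda>I. length (items I)), yes = has_subset_sum\<rparr>"

end

theory Submission
  imports Defs
begin

text \<open>
  The equation \<open>\<Sum>z\<^sub>ix\<^sub>i = t\<close> is replaced by the congruences \<open>\<Sum>z\<^sub>ix\<^sub>i \<equiv> t (mod q)\<close> for all \<open>q \<le> K\<close>.
  Congruences are affine and hence preserved by \<open>e2\<close>.  Since the least common multiple of
  \<open>1, \<dots>, 2k\<close> is at least \<open>2^k\<close>, some \<open>K\<close> linear in the bit length of \<open>t + \<Sum>x\<^sub>i\<close> makes
  the congruences equivalent to the equation.  All moduli are then polynomial in the input size, so an
  extension query can be answered in polynomial time by dynamic programming over the residues.  Replacing
  each oracle call of the given program by this computation costs a polynomial factor only.
\<close>

section \<open>Bit lengths\<close>

text \<open>The equation itself is already closed under \<open>e2\<close>; it is the oracle that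
  forces the congruences. An extension query to the equation fixes some of the \<open>z\<close> and
  asks about the others, which is Subset Sum again, so no cheap code could stand in for the answer.
  Modulo a small \<open>q\<close> the same query has only \<open>q\<close> states per item. Taking
  every modulus up to \<open>K\<close>, and not just primes, lets the instance be written down
  without any search for moduli; the number theory shrinks to a lower bound on common multiples. The
  instance has one variable per item, so the exponent of the given algorithm carries over as long as
  every other loss is polynomial. One obstacle remains: the given program chooses its queries
  freely. They may be very long, contain huge numbers, be out of range or contradict themselves.
  Hence the simulation of a call is measured against the price that \<open>exec\<close> sets for
  that call, and not against the input size alone.\<close>

lemma bits_pos [simp]: "0 < bits x"
  by (simp add: bits_def)

lemma bits_mono: "x \<le> y \<Longrightarrow> bits x \<le> bits y"
  by (simp add: bits_def floor_log_le_iff)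

lemma less_two_power_bits: "x < 2 ^ bits x"
  using floor_log_exp2_gt[of x] by (simp add: bits_def)

lemma bits_leI: "x < 2 ^ k \<Longrightarrow> 0 < k \<Longrightarrow> bits x \<le> k"
  using floor_log_exp2_le[of x] unfolding bits_def
  by (cases "x = 0") (auto simp: Suc_le_eq intro: power_less_imp_less_exp[of "2::nat"] order.strict_trans1)

lemma bits_mult_le: "bits (x * y) \<le> bits x + bits y"
  by (rule bits_leI)
    (simp_all add: power_add mult_strict_mono less_two_power_bits)

lemma bits_add_le: "bits (x + y) \<le> bits x + bits y"
proof (rule bits_leI)
  \<comment> \<open>The product on the left exceeds \<open>x + y\<close>, so strictness in both
    factors pays for the sum.\<close>
  have "Suc x * Suc y \<le> 2 ^ bits x * 2 ^ bits y"
    using less_two_power_bits by (intro mult_le_mono) (simp_all add: Suc_leI)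
  then show "x + y < 2 ^ (bits x + bits y)"
    by (simp add: power_add)
qed simp

lemma bits_apply_op_le: "bits (apply_op f x y) \<le> bits x + bits y"
proof (cases f)
  case Sub
  then show ?thesis using bits_mono[of "x - y" x] by simp
next
  case Div
  then show ?thesis using bits_mono[of "x div y" x] by simp
qed (simp_all add: bits_add_le bits_mult_le)

lemma bits_le_Suc: "bits x \<le> Suc x"
  using less_exp[of "Suc x"] by (intro bits_leI) simp_all

lemma bits_0 [simp]: "bits 0 = 1"
  and bits_Suc_0 [simp]: "bits (Suc 0) = 1"
  and bits_2 [simp]: "bits 2 = 2"
  using floor_log_rec[of 2] by (simp_all add: bits_def)

lemma bits_Suc_le: "bits (Suc x) \<le> bits x + 1"
  using bits_add_le[of x 1] by simp

text \<open>Evaluating an expression already pays for its result. This bounds values computed by the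
  given program, about whose size nothing else is known.\<close>

lemma bits_eval_le_ecost: "bits (eval e s) \<le> ecost e s"
  by (induction e) (auto intro: order.trans[OF bits_apply_op_le])

section \<open>Common multiples of the first integers\<close>

text \<open>
  By the recurrence \<open>1 / ((m+1) C(n,m+1)) = 1 / (m C(n-1,m)) - 1 / (m C(n,m))\<close> of the Leibniz harmonic
  triangle, all quotients \<open>D / (m C(n,m))\<close> are integers as soon as all \<open>D / n\<close> are.
\<close>

lemma Leibniz_triangle_dvd:
  fixes D :: nat
  assumes "\<And>q. 0 < q \<Longrightarrow> q \<le> K \<Longrightarrow> q dvd D" and "0 < m" "m \<le> n" "n \<le> K"
  shows "m * (n choose m) dvd D"
  using assms(2-)
proof (induction m arbitrary: n)
  case 0
  then show ?case by simp
next
  case (Suc m)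
  show ?case
  proof (cases "m = 0")
    case True
    then show ?thesis using assms(1) Suc.prems by simp
  next
    case False
    obtain k where n: "n = Suc k" using Suc.prems by (cases n) auto
    define h g a b c where "h = k choose m" and "g = k choose (m - 1)" and "a = m * h"
      and "b = m * (n choose m)" and "c = Suc m * (n choose Suc m)"
    have "a dvd D" "b dvd D"
      unfolding a_def b_def h_def using Suc.IH[of k] Suc.IH[of n] Suc.prems False n by auto
    then obtain p q where p: "D = a * p" and q: "D = b * q"
      unfolding dvd_def by blast
    have b: "b = m * (g + h)" "b = n * g" and c: "c = n * h"
      unfolding b_def c_def g_def h_def using False n times_binomial_minus1_eq[of m n]
        times_binomial_minus1_eq[of "Suc m" n] choose_reduce_nat[of n m] by simp_all
    have "0 < a" "0 < b"
      unfolding a_def b_def h_def using False Suc.prems n by simp_all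
    \<comment> \<open>The recurrence \<open>1/c = 1/a - 1/b\<close> cleared of denominators; it
      makes \<open>p - q\<close> the quotient of \<open>D\<close> by \<open>c\<close>.\<close>
    have cb: "c * b = a * b + c * a"
      by (subst (2) b(2)) (simp add: b(1) a_def c algebra_simps)
    have "(c * p) * (a * b) = (c * b) * D" using p by simp
    also have "\<dots> = (D + c * q) * (a * b)"
      unfolding cb by (simp add: algebra_simps) (simp add: q)
    finally have "c * p = D + c * q" using \<open>0 < a\<close> \<open>0 < b\<close> by simp
    then have "D = c * (p - q)" by (simp add: diff_mult_distrib2)
    then show ?thesis unfolding c_def by (metis dvd_triv_left)
  qed
qed

text \<open>The central entry \<open>m = k\<close>, \<open>n = 2 * k\<close> of the triangle divides
  \<open>D\<close>. Its factor \<open>k\<close> cancels the denominator in the bound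
  \<open>4^k / (2k)\<close> for the central binomial coefficient, which leaves
  \<open>4^k / 2\<close>. The claim is made for any positive common multiple because it is applied
  to the distance between a subset sum and the target.\<close>

lemma common_multiple_lower_bound:
  fixes D :: nat
  assumes "\<And>q. 0 < q \<Longrightarrow> q \<le> 2 * k \<Longrightarrow> q dvd D" and "0 < k" and "0 < D"
  shows "2 ^ k \<le> D"
proof -
  have "k * (2 * k choose k) dvd D"
    using Leibniz_triangle_dvd[of "2 * k" D k "2 * k"] assms by simp
  then have "k * (2 * k choose k) \<le> D" using \<open>0 < D\<close> by (rule dvd_imp_le)
  then have "real k * real (2 * k choose k) \<le> real D" by (metis of_nat_le_iff of_nat_mult)
  moreover have "4 ^ k / 2 \<le> real k * real (2 * k choose k)"
    using central_binomial_lower_bound[OF \<open>0 < k\<close>] \<open>0 < k\<close> by (simp add: field_simps)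
  moreover have "(2::real) ^ k \<le> 4 ^ k / 2"
  proof -
    have "(2::real) * 2 ^ k \<le> 2 ^ k * 2 ^ k"
      using \<open>0 < k\<close> by (intro mult_right_mono) (simp_all add: self_le_power)
    then show ?thesis by (simp flip: power_mult_distrib)
  qed
  ultimately have "2 ^ k \<le> real D" by linarith
  then show ?thesis by (metis of_nat_le_iff of_nat_numeral of_nat_power)
qed

section \<open>Timed program logic\<close>

text \<open>Total correctness with a time budget: a derivation of \<open>exec\<close> exists only
  for halting runs, and by determinism it describes the only run. A budget in place of the exact
  time lets bounds be added and rounded up.\<close>

definition runs :: "query_oracle \<Rightarrow> prog \<Rightarrow> state \<Rightarrow> nat \<Rightarrow> (state \<Rightarrow> bool) \<Rightarrow> bool" where
  "runs Q p s B R \<longleftrightarrow> (\<exists>T s'. exec Q p s T s' \<and> T \<le> B \<and> R s')"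

lemma runsI: "exec Q p s T s' \<Longrightarrow> T \<le> B \<Longrightarrow> R s' \<Longrightarrow> runs Q p s B R"
  unfolding runs_def by blast

lemma runs_mono:
  "runs Q p s B R \<Longrightarrow> B \<le> B' \<Longrightarrow> (\<And>s'. R s' \<Longrightarrow> R' s') \<Longrightarrow> runs Q p s B' R'"
  unfolding runs_def using order.trans by blast

lemma runs_Seq:
  "runs Q p1 s B1 (\<lambda>s'. runs Q p2 s' B2 R) \<Longrightarrow> runs Q (Seq p1 p2) s (B1 + B2) R"
  unfolding runs_def by (meson exec.Seq add_mono)

lemma runs_SeqI:
  assumes "runs Q p1 s B1 P" "\<And>s'. P s' \<Longrightarrow> runs Q p2 s' B2 R"
  shows "runs Q (Seq p1 p2) s (B1 + B2) R"
  by (rule runs_Seq, rule runs_mono[OF assms(1) order.refl]) (rule assms(2))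

lemma runs_While:
  assumes "eval e s \<noteq> 0" "runs Q p s B1 P" "\<And>s'. P s' \<Longrightarrow> runs Q (While e p) s' B2 R"
  shows "runs Q (While e p) s (1 + ecost e s + B1 + B2) R"
proof -
  obtain T1 s1 where 1: "exec Q p s T1 s1" "T1 \<le> B1" "P s1"
    using assms(2) unfolding runs_def by blast
  then obtain T2 s2 where 2: "exec Q (While e p) s1 T2 s2" "T2 \<le> B2" "R s2"
    using assms(3) unfolding runs_def by blast
  show ?thesis
    by (rule runsI[OF exec.WhileTrue[OF assms(1) 1(1) 2(1)]]) (use 1 2 in simp_all)
qed

text \<open>An operation at most adds the bit lengths of its operands, so bounding the leaves by
  \<open>W\<close> bounds every value inside the expression by \<open>leaves\<close> times
  \<open>W\<close>. An array read counts as one new leaf, since the size of a cell is unrelated to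
  the size of its index.\<close>

fun leaves_small :: "nat \<Rightarrow> expr \<Rightarrow> state \<Rightarrow> bool" where
  "leaves_small W (Const k) s \<longleftrightarrow> bits k \<le> W"
| "leaves_small W (Var x) s \<longleftrightarrow> bits (var s x) \<le> W"
| "leaves_small W (Arr a e) s \<longleftrightarrow> leaves_small W e s \<and> bits (arr s a (eval e s)) \<le> W"
| "leaves_small W (Op f d e) s \<longleftrightarrow> leaves_small W d s \<and> leaves_small W e s"

fun leaves :: "expr \<Rightarrow> nat" where
  "leaves (Op f d e) = leaves d + leaves e"
| "leaves _ = 1"

text \<open>The coefficient of \<open>W\<close> in the cost bound; the \<open>leaves\<close>
  summands pay for the index or the operands, which the logarithmic cost criterion charges again at
  each node.\<close>

fun weight :: "expr \<Rightarrow> nat" where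
  "weight (Arr a e) = weight e + leaves e + 1"
| "weight (Op f d e) = weight d + weight e + leaves d + leaves e"
| "weight _ = 1"

lemma bits_eval_le: "leaves_small W e s \<Longrightarrow> bits (eval e s) \<le> leaves e * W"
proof (induction e)
  case (Op f d e)
  then show ?case
    using bits_apply_op_le[of f "eval d s" "eval e s"] by (simp add: add_mult_distrib)
qed simp_all

lemma ecost_le: "leaves_small W e s \<Longrightarrow> ecost e s \<le> weight e * W"
proof (induction e)
  case (Arr a e)
  then show ?case using bits_eval_le[of W e s] by (simp add: add_mult_distrib)
next
  case (Op f d e)
  then show ?case
    using bits_eval_le[of W d s] bits_eval_le[of W e s] by (simp add: add_mult_distrib)
qed simp_all

text \<open>
  Weakest preconditions for loop-free, oracle-free programs that only ever read values of at most \<open>W\<close> bits;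
  such a run takes time at most \<open>pweight p * W\<close>.
\<close>

fun wp :: "nat \<Rightarrow> prog \<Rightarrow> (state \<Rightarrow> bool) \<Rightarrow> state \<Rightarrow> bool" where
  "wp W Skip R s \<longleftrightarrow> R s"
| "wp W (Assign x e) R s \<longleftrightarrow> leaves_small W e s \<and> R (set_var x (eval e s) s)"
| "wp W (Store a d e) R s \<longleftrightarrow>
    leaves_small W d s \<and> leaves_small W e s \<and> R (set_arr a (eval d s) (eval e s) s)"
| "wp W (Seq p1 p2) R s \<longleftrightarrow> wp W p1 (wp W p2 R) s"
| "wp W (If e p1 p2) R s \<longleftrightarrow>
    leaves_small W e s \<and> (if eval e s \<noteq> 0 then wp W p1 R s else wp W p2 R s)"
| "wp W (While e p) R s \<longleftrightarrow> False"
| "wp W (Ask x ej ek a b) R s \<longleftrightarrow> False"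

fun pweight :: "prog \<Rightarrow> nat" where
  "pweight (Assign x e) = 1 + weight e + leaves e"
| "pweight (Store a d e) = 1 + weight d + weight e + leaves d + leaves e"
| "pweight (Seq p1 p2) = pweight p1 + pweight p2"
| "pweight (If e p1 p2) = 1 + weight e + pweight p1 + pweight p2"
| "pweight _ = 1"

lemma runs_wp:
  assumes "wp W p R s" and W: "0 < W"
  shows "runs Q p s (pweight p * W) R"
  using assms(1)
proof (induction p arbitrary: R s)
  case Skip
  then show ?case using W by (intro runsI[OF exec.Skip]) auto
next
  case (Assign x e)
  then show ?case
    using ecost_le[of W e s] bits_eval_le[of W e s] W
    by (intro runsI[OF exec.Assign]) (auto simp: add_mult_distrib)
next
  case (Store a d e)
  then show ?case
    using ecost_le[of W d s] bits_eval_le[of W d s] ecost_le[of W e s] bits_eval_le[of W e s] W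
    by (intro runsI[OF exec.Store]) (auto simp: add_mult_distrib)
next
  case (Seq p1 p2)
  then have "runs Q p1 s (pweight p1 * W) (wp W p2 R)" by simp
  then show ?case unfolding pweight.simps add_mult_distrib by (rule runs_SeqI) (rule Seq.IH)
next
  case (If e p1 p2)
  then have *: "ecost e s \<le> weight e * W" by (simp add: ecost_le)
  show ?case
  proof (cases "eval e s = 0")
    case True
    with If obtain T s' where "exec Q p2 s T s'" "T \<le> pweight p2 * W" "R s'"
      unfolding runs_def by fastforce
    with True W * show ?thesis 
      by (intro runsI[OF exec.IfFalse]) (auto simp: add_mult_distrib)
  next
    case False
    with If obtain T s' where "exec Q p1 s T s'" "T \<le> pweight p1 * W" "R s'"
      unfolding runs_def by fastforce
    with False W * show ?thesis 
      by (intro runsI[OF exec.IfTrue]) (auto simp: add_mult_distrib)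
  qed
qed simp_all

section \<open>Counting loops\<close>

definition Countdown :: "nat \<Rightarrow> prog \<Rightarrow> prog" where
  "Countdown l p = While (Var l) (Seq (Assign l (Op Sub (Var l) (Const 1))) p)"

lemma var_set_var [simp]: "var (set_var x v s) = (var s)(x := v)"
  and arr_set_var [simp]: "arr (set_var x v s) = arr s"
  and var_set_arr [simp]: "var (set_arr a i v s) = var s"
  and arr_set_arr [simp]: "arr (set_arr a i v s) = (arr s)(a := (arr s a)(i := v))"
  by (simp_all add: set_var_def set_arr_def)

text \<open>The counter is decremented before the body runs, so the body sees the zero-based index
  \<open>m\<close>, in descending order, and \<open>I m\<close> can say that everything from
  \<open>m\<close> on is done. The term \<open>12 * bits m\<close> covers test and decrement, and 2
  is the final failing test. The budget \<open>B\<close> may depend on \<open>m\<close>, as needed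
  when rounds are charged to the entries of a query.\<close>

lemma runs_Countdown:
  assumes "I k s" "var s l = k"
    and body: "\<And>m s. m < k \<Longrightarrow> I (Suc m) s \<Longrightarrow> var s l = Suc m \<Longrightarrow>
      runs Q p (set_var l m s) (B m) (\<lambda>s'. I m s' \<and> var s' l = m)"
  shows "runs Q (Countdown l p) s (2 + (\<Sum>m<k. B m + 12 * bits m)) (\<lambda>s'. I 0 s' \<and> var s' l = 0)"
  using assms
proof (induction k arbitrary: s)
  case 0
  then show ?case unfolding Countdown_def
    by (intro runsI[OF exec.WhileFalse]) simp_all
next
  case (Suc m)
  have "runs Q p (set_var l m s) (B m) (\<lambda>s'. I m s' \<and> var s' l = m)"
    using Suc.prems by simp
  then obtain T1 s1 where 1: "exec Q p (set_var l m s) T1 s1" "T1 \<le> B m" "I m s1" "var s1 l = m"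
    unfolding runs_def by blast
  from Suc.IH[OF 1(3,4)] Suc.prems(3) obtain T2 s2 where
    2: "exec Q (Countdown l p) s1 T2 s2" "T2 \<le> 2 + (\<Sum>m<m. B m + 12 * bits m)"
      "I 0 s2" "var s2 l = 0"
    unfolding runs_def by (metis less_SucI)
  have "exec Q (Assign l (Op Sub (Var l) (Const 1))) s
      (1 + ecost (Op Sub (Var l) (Const 1)) s + bits m) (set_var l m s)"
    using exec.Assign[of Q l "Op Sub (Var l) (Const 1)" s] Suc.prems(2) by simp
  from exec.WhileTrue[OF _ exec.Seq[OF this 1(1)] 2(1)[unfolded Countdown_def]] Suc.prems(2)
  have "exec Q (Countdown l p) s (1 + bits (Suc m) +
      (1 + (bits (Suc m) + 1 + (bits (Suc m) + 1)) + bits m + T1) + T2) s2"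
    unfolding Countdown_def by simp
  moreover have "1 + bits (Suc m) + (1 + (bits (Suc m) + 1 + (bits (Suc m) + 1)) + bits m + T1) + T2
      \<le> 2 + (\<Sum>m<Suc m. B m + 12 * bits m)"
    using 1(2) 2(2) bits_Suc_le[of m] bits_pos[of m] unfolding sum.lessThan_Suc by linarith
  ultimately show ?case unfolding runs_def using 2 by blast
qed

lemma runs_Countdown_uniform:
  assumes "I k s" "var s l = k"
    and "\<And>m s. m < k \<Longrightarrow> I (Suc m) s \<Longrightarrow> var s l = Suc m \<Longrightarrow>
      wp W p (\<lambda>s'. I m s' \<and> var s' l = m) (set_var l m s)"
    and "bits k \<le> W"
  shows "runs Q (Countdown l p) s (2 + k * ((pweight p + 12) * W)) (\<lambda>s'. I 0 s' \<and> var s' l = 0)"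
proof -
  have "0 < W" using assms(4) bits_pos[of k] by linarith
  have "(\<Sum>m<k. pweight p * W + 12 * bits m) \<le> (\<Sum>m<k. (pweight p + 12) * W)"
  proof (rule sum_mono)
    fix m
    assume "m \<in> {..<k}"
    then have "bits m \<le> W" using assms(4) bits_mono[of m k] by simp
    then show "pweight p * W + 12 * bits m \<le> (pweight p + 12) * W" by (simp add: add_mult_distrib)
  qed
  moreover have "runs Q (Countdown l p) s (2 + (\<Sum>m<k. pweight p * W + 12 * bits m))
      (\<lambda>s'. I 0 s' \<and> var s' l = 0)"
    using assms(1-3) by (intro runs_Countdown runs_wp \<open>0 < W\<close>)
  ultimately show ?thesis by (elim runs_mono) simp_all
qed

section \<open>Subset sums as systems of congruences\<close>

definition congruence_relation :: "nat \<Rightarrow> nat list \<Rightarrow> nat \<Rightarrow> relation" where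
  "congruence_relation t xs q = (length xs,
    {u. length u = length xs \<and> (\<Sum>i<length xs. of_bool (u ! i) * xs ! i) mod q = t mod q})"

text \<open>Every scope is the full list of variables, so coordinates and variables coincide and the
  explicit input depends on \<open>K\<close> and the number of items only; the integers are hidden
  in the oracle. Modulus \<open>Suc j\<close> for constraint \<open>j\<close> avoids modulus 0,
  which would mean the exact equation.\<close>

definition congruence_instance :: "nat \<Rightarrow> nat list \<Rightarrow> nat \<Rightarrow> sat_instance" where
  "congruence_instance t xs K =
    \<lparr>nvars = length xs,
     constraints = map (\<lambda>j. (congruence_relation t xs (Suc j), [0..<length xs])) [0..<K]\<rparr>"

text \<open>The operation is the restriction of the Mal'cev operation \<open>b - a + c\<close>.\<close>

lemma e2_SomeD: "e2 a b c = Some d \<Longrightarrow> of_bool d + of_bool a = (of_bool b + of_bool c :: nat)"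
  by (auto simp: e2_def split: if_splits)

text \<open>Summing the identity for single bits gives \<open>S y + S u = S v + S w\<close>. Three
  of these sums being congruent to \<open>t\<close>, so is the fourth; the integers are used because
  subtraction is truncated on \<open>nat\<close>.\<close>

lemma congruence_relation_in_Inv: "congruence_relation t xs q \<in> Inv e2"
proof -
  define S where "S u = (\<Sum>i<length xs. of_bool (u ! i) * xs ! i)" for u :: "bool list"
  have "S y mod q = t mod q"
    if "S u mod q = t mod q" "S v mod q = t mod q" "S w mod q = t mod q"
      and y: "\<forall>i<length xs. e2 (u ! i) (v ! i) (w ! i) = Some (y ! i)" for u v w y
  proof -
    have "S y + S u = S v + S w"
      unfolding S_def sum.distrib[symmetric] add_mult_distrib[symmetric]
      using y by (intro sum.cong refl) (simp add: e2_SomeD)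
    then have "int (S y) = int (S v) + int (S w) - int (S u)" by linarith
    also have "\<dots> mod int q = (int t + int t - int t) mod int q"
      using that(1-3) by (intro mod_diff_cong mod_add_cong) (simp_all flip: of_nat_mod)
    finally show ?thesis by (simp flip: of_nat_mod)
  qed
  then show ?thesis
    unfolding Inv_def congruence_relation_def is_relation_def preserves_def S_def by auto
qed

lemma congruence_instance_in_sat_instances: "congruence_instance t xs K \<in> sat_instances (Inv e2)"
  using congruence_relation_in_Inv
  by (auto simp: sat_instances_def congruence_instance_def congruence_relation_def)

lemma sum_of_bool_le_sum_list:
  "(\<Sum>i<length xs. of_bool (z i) * xs ! i) \<le> sum_list (xs :: nat list)"
  unfolding sum_list_sum_nth atLeast0LessThan by (intro sum_mono) simp

text \<open>If all congruences hold but the sum misses the target, their distance \<open>D\<close>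
  is a positive common multiple of all numbers up to \<open>2 * k\<close>, hence at least
  \<open>2 ^ k\<close>; yet it is at most \<open>t + sum_list xs\<close>.\<close>

lemma satisfiable_congruence_instance:
  assumes bound: "t + sum_list xs < 2 ^ k" and "0 < k" and "2 * k \<le> K"
  shows "satisfiable (congruence_instance t xs K) \<longleftrightarrow> has_subset_sum \<lparr>target = t, items = xs\<rparr>"
proof -
  define S where "S z = (\<Sum>i<length xs. of_bool (z i) * xs ! i)" for z
  have "S z = t" if all: "\<forall>j<K. S z mod Suc j = t mod Suc j" for z
  proof (rule ccontr)
    assume "S z \<noteq> t"
    define D where "D = nat \<bar>int (S z) - int t\<bar>"
    have "q dvd D" if "0 < q" "q \<le> 2 * k" for q
    proof -
      have "S z mod q = t mod q" using all[rule_format, of "q - 1"] that assms(3) by simp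
      then have "int q dvd int (S z) - int t"
        by (simp add: mod_eq_dvd_iff[symmetric] of_nat_mod[symmetric])
      then show ?thesis unfolding D_def by (simp add: nat_dvd_iff)
    qed
    moreover have "0 < D" using \<open>S z \<noteq> t\<close> by (simp add: D_def)
    ultimately have "2 ^ k \<le> D" using common_multiple_lower_bound[of k D] \<open>0 < k\<close> by blast
    moreover have "D \<le> t + sum_list xs"
      using sum_of_bool_le_sum_list[of z xs] unfolding D_def S_def by linarith
    ultimately show False using bound by simp
  qed
  then have "(\<forall>j<K. S z mod Suc j = t mod Suc j) \<longleftrightarrow> S z = t" for z by auto
  moreover have "S ((!) (map z [0..<length xs])) = S z" for z
    unfolding S_def by (intro sum.cong) simp_all
  then have "satisfiable (congruence_instance t xs K) \<longleftrightarrow>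
      (\<exists>z. \<forall>j<K. S z mod Suc j = t mod Suc j)"
    unfolding satisfiable_def congruence_instance_def congruence_relation_def
    by (simp add: S_def[symmetric] atLeast0LessThan del: sum_of_bool_mult_eq sum_mult_of_bool_eq)
      (simp add: Ball_def)
  moreover have "has_subset_sum \<lparr>target = t, items = xs\<rparr> \<longleftrightarrow> (\<exists>z. S z = t)"
  proof
    assume "has_subset_sum \<lparr>target = t, items = xs\<rparr>"
    then obtain z :: "nat \<Rightarrow> nat" where z: "\<forall>i<length xs. z i \<in> {0, 1}"
      and sum: "(\<Sum>i<length xs. z i * xs ! i) = t"
      by (auto simp: has_subset_sum_def)
    have "S (\<lambda>i. z i = 1) = (\<Sum>i<length xs. z i * xs ! i)"
      unfolding S_def using z by (intro sum.cong) auto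
    with sum show "\<exists>z. S z = t" by blast
  next
    assume "\<exists>z. S z = t"
    then obtain z where "S z = t" by blast
    then show "has_subset_sum \<lparr>target = t, items = xs\<rparr>"
      unfolding has_subset_sum_def S_def by (intro exI[of _ "\<lambda>i. of_bool (z i)"]) auto
  qed
  ultimately show ?thesis by simp
qed

section \<open>The explicit encoding of the congruence instance\<close>

lemma nth_concat_replicate:
  "i < K * length ys \<Longrightarrow> concat (replicate K ys) ! i = ys ! (i mod length ys)"
proof (induction K arbitrary: i)
  case (Suc K)
  then show ?case by (cases "i < length ys") (simp_all add: nth_append mod_if)
qed simp

lemma encode_congruence_instance:
  "encode_sat (congruence_instance t xs K) =
    length xs # K # concat (replicate K (length xs # [0..<length xs]))"
  unfolding encode_sat_def congruence_instance_def congruence_relation_def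
  by (simp add: comp_def map_replicate_const)

lemma length_encode_congruence_instance:
  "length (encode_sat (congruence_instance t xs K)) = 2 + K * Suc (length xs)"
  unfolding encode_congruence_instance by (simp add: length_concat sum_list_replicate)

text \<open>After the two header words the encoding is periodic, each block being a scope length
  followed by the scope. This closed form lets the program compute every cell from its index
  alone.\<close>

lemma nth_encode_congruence_instance:
  assumes "i < K * Suc (length xs)"
  shows "encode_sat (congruence_instance t xs K) ! Suc (Suc i) =
    (if i mod Suc (length xs) = 0 then length xs else i mod Suc (length xs) - 1)"
proof -
  define m where "m = i mod Suc (length xs)"
  have "m < Suc (length xs)" unfolding m_def by simp
  with assms show ?thesis
    unfolding encode_congruence_instance
    using nth_concat_replicate[of i K "length xs # [0..<length xs]"]
    by (cases m) (simp_all flip: m_def)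
qed

lemma input_size_encode_congruence_instance:
  "input_size (encode_sat (congruence_instance t xs K)) \<le>
    (2 + K * Suc (length xs)) * (length xs + K + 1)"
proof -
  have "bits w \<le> length xs + K + 1" if "w \<in> set (encode_sat (congruence_instance t xs K))" for w
    using that bits_le_Suc[of w] unfolding encode_congruence_instance by (auto split: if_splits)
  then have "input_size (encode_sat (congruence_instance t xs K)) \<le>
      (\<Sum>w\<leftarrow>encode_sat (congruence_instance t xs K). length xs + K + 1)"
    unfolding input_size_def by (rule sum_list_mono)
  then show ?thesis
    by (simp only: sum_list_triv length_encode_congruence_instance of_nat_id)
qed

section \<open>Extension queries as reachability among residues\<close>

definition reaches :: "nat \<Rightarrow> nat list \<Rightarrow> nat \<Rightarrow> (nat \<Rightarrow> bool \<Rightarrow> bool) \<Rightarrow> nat \<Rightarrow> nat \<Rightarrow> bool" where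
  "reaches t xs q A i r \<longleftrightarrow> (\<exists>z. (\<forall>h. i \<le> h \<and> h < length xs \<longrightarrow> A h (z h)) \<and>
    (r + (\<Sum>h=i..<length xs. of_bool (z h) * xs ! h)) mod q = t mod q)"

lemma reaches_end: "reaches t xs q A (length xs) r \<longleftrightarrow> r mod q = t mod q"
  by (auto simp: reaches_def)

text \<open>Partial sums matter only through their residues, so a table with \<open>q\<close> cells
  per item suffices.\<close>

lemma reaches_mod: "reaches t xs q A i (r mod q) \<longleftrightarrow> reaches t xs q A i r"
  by (simp add: reaches_def mod_add_left_eq)

text \<open>Splitting on the value of \<open>z i\<close> gives the recurrence between consecutive
  rows of the table.\<close>

lemma reaches_step:
  assumes "i < length xs"
  shows "reaches t xs q A i r \<longleftrightarrow>
    A i False \<and> reaches t xs q A (Suc i) r \<or> A i True \<and> reaches t xs q A (Suc i) (r + xs ! i)"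
    (is "?L \<longleftrightarrow> ?R")
proof
  assume ?L
  then obtain z where A: "\<forall>h. i \<le> h \<and> h < length xs \<longrightarrow> A h (z h)"
    and "(r + (\<Sum>h=i..<length xs. of_bool (z h) * xs ! h)) mod q = t mod q"
    unfolding reaches_def by blast
  then have "(r + of_bool (z i) * xs ! i + (\<Sum>h=Suc i..<length xs. of_bool (z h) * xs ! h)) mod q
      = t mod q"
    using assms by (simp add: sum.atLeast_Suc_lessThan add.assoc del: sum_of_bool_mult_eq)
  moreover have "\<forall>h. Suc i \<le> h \<and> h < length xs \<longrightarrow> A h (z h)" using A by auto
  ultimately have "reaches t xs q A (Suc i) (r + of_bool (z i) * xs ! i)"
    unfolding reaches_def by blast
  moreover have "A i (z i)" using A assms by simp
  ultimately show ?R by (cases "z i") simp_all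
next
  assume ?R
  then obtain b where "A i b" "reaches t xs q A (Suc i) (r + of_bool b * xs ! i)"
    by (metis add.right_neutral mult_zero_left mult_1 of_bool_eq(1) of_bool_eq(2))
  then obtain z where A: "\<forall>h. Suc i \<le> h \<and> h < length xs \<longrightarrow> A h (z h)"
    and sum: "(r + of_bool b * xs ! i + (\<Sum>h=Suc i..<length xs. of_bool (z h) * xs ! h)) mod q
      = t mod q"
    unfolding reaches_def by blast
  have "(\<Sum>h=i..<length xs. of_bool ((z(i := b)) h) * xs ! h) =
      of_bool b * xs ! i + (\<Sum>h=Suc i..<length xs. of_bool (z h) * xs ! h)"
    using assms by (simp add: sum.atLeast_Suc_lessThan del: sum_of_bool_mult_eq)
  moreover have "\<forall>h. i \<le> h \<and> h < length xs \<longrightarrow> A h ((z(i := b)) h)"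
    using A \<open>A i b\<close> by (auto simp: Suc_le_eq)
  ultimately show ?L
    using sum unfolding reaches_def by (intro exI[of _ "z(i := b)"]) (simp add: add.assoc)
qed

text \<open>
  The mark \<open>2h + b\<close> stands for a query asking that coordinate \<open>h\<close> have the value \<open>b\<close>, so that
  value \<open>v\<close> is allowed at \<open>h\<close> iff the opposite mark is absent.
\<close>

definition marks :: "nat \<Rightarrow> (nat \<Rightarrow> nat) \<Rightarrow> (nat \<Rightarrow> nat) \<Rightarrow> nat set" where
  "marks k f g = (\<lambda>l. 2 * f l + g l) ` {..<k}"

definition allowed :: "nat set \<Rightarrow> nat \<Rightarrow> bool \<Rightarrow> bool" where
  "allowed M h v \<longleftrightarrow> 2 * h + of_bool (\<not> v) \<notin> M"

text \<open>A tuple agrees with the query iff it never takes a value whose opposite is marked. A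
  contradictory query marks both values of a coordinate, which leaves none allowed, so it needs no
  special treatment. Values \<open>g l\<close> of 2 or more must be rejected separately: their marks
  would be read as marks of another coordinate.\<close>

lemma extension_oracle_congruence_instance:
  "extension_oracle (congruence_instance t xs K) j (map f [0..<k]) (map g [0..<k]) \<longleftrightarrow>
    j < K \<and> (\<forall>l<k. f l < length xs \<and> g l < 2) \<and>
    reaches t xs (Suc j) (allowed (marks k f g)) 0 0"
proof -
  have iff: "(\<exists>u. length u = length xs \<and>
      (\<Sum>i<length xs. of_bool (u ! i) * xs ! i) mod Suc j = t mod Suc j \<and>
      (\<forall>l<k. g l = of_bool (u ! f l))) \<longleftrightarrow>
    (\<forall>l<k. g l < 2) \<and> reaches t xs (Suc j) (allowed (marks k f g)) 0 0"
    (is "?L \<longleftrightarrow> ?R") if f: "\<forall>l<k. f l < length xs"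
  proof
    assume ?L
    then obtain u where sum: "(\<Sum>i<length xs. of_bool (u ! i) * xs ! i) mod Suc j = t mod Suc j"
      and u: "\<And>l. l < k \<Longrightarrow> g l = of_bool (u ! f l)"
      by blast
    have "allowed (marks k f g) h (u ! h)" for h
    proof (rule ccontr)
      assume "\<not> allowed (marks k f g) h (u ! h)"
      then obtain l where l: "l < k" "2 * h + of_bool (\<not> u ! h) = 2 * f l + of_bool (u ! f l)"
        using u by (auto simp: allowed_def marks_def)
      \<comment> \<open>Halving both sides identifies the coordinates; the parities then demand
        opposite bits.\<close>
      then have "h = f l" by (cases "u ! h"; cases "u ! f l"; simp; presburger?)
      with l show False by (cases "u ! h") simp_all
    qed
    with sum have "reaches t xs (Suc j) (allowed (marks k f g)) 0 0"
      unfolding reaches_def by (intro exI[of _ "(!) u"]) (simp add: atLeast0LessThan)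
    then show ?R using u by simp
  next
    assume R: ?R
    then obtain z where A: "\<And>h. h < length xs \<Longrightarrow> allowed (marks k f g) h (z h)"
      and sum: "(\<Sum>h<length xs. of_bool (z h) * xs ! h) mod Suc j = t mod Suc j"
      unfolding reaches_def by (auto simp: atLeast0LessThan)
    define u where "u = map z [0..<length xs]"
    have "g l = of_bool (u ! f l)" if "l < k" for l
    proof (rule ccontr)
      assume "g l \<noteq> of_bool (u ! f l)"
      moreover have "g l < 2" using R that by blast
      ultimately have "g l = of_bool (\<not> z (f l))"
        using f that by (cases "z (f l)") (auto simp: u_def)
      then have "2 * f l + of_bool (\<not> z (f l)) \<in> marks k f g"
        unfolding marks_def using that by (intro image_eqI[of _ _ l]) simp_all
      with A[of "f l"] f that show False by (simp add: allowed_def)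
    qed
    moreover have "(\<Sum>i<length xs. of_bool (u ! i) * xs ! i) mod Suc j = t mod Suc j"
      unfolding u_def using sum by simp
    ultimately show ?L by (intro exI[of _ u]) (simp add: u_def)
  qed
  have "extension_oracle (congruence_instance t xs K) j (map f [0..<k]) (map g [0..<k]) \<longleftrightarrow>
    j < K \<and> (\<forall>l<k. f l < length xs) \<and>
    (\<exists>u \<in> snd (congruence_relation t xs (Suc j)). \<forall>l<k. g l = of_bool (u ! f l))"
  proof (cases "j < K")
    case True
    then have "fst (constraints (congruence_instance t xs K) ! j) = congruence_relation t xs (Suc j)"
      by (simp add: congruence_instance_def)
    moreover have "fst (congruence_relation t xs (Suc j)) = length xs"
      by (simp add: congruence_relation_def)
    moreover have "map g [0..<k] = map of_bool (map ((!) u) (map f [0..<k])) \<longleftrightarrow>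
        (\<forall>l<k. g l = of_bool (u ! f l))" for u :: "bool list"
      by (auto simp: comp_def)
    ultimately show ?thesis
      using True unfolding extension_oracle_def Let_def projection_def
      by (simp add: congruence_instance_def image_subset_iff) (simp add: Ball_def)
  qed (simp add: extension_oracle_def congruence_instance_def)
  also have "\<dots> \<longleftrightarrow> j < K \<and> (\<forall>l<k. f l < length xs) \<and> (\<exists>u. length u = length xs \<and>
      (\<Sum>i<length xs. of_bool (u ! i) * xs ! i) mod Suc j = t mod Suc j \<and>
      (\<forall>l<k. g l = of_bool (u ! f l)))"
    unfolding congruence_relation_def snd_conv by blast
  finally show ?thesis using iff by blast
qed

section \<open>Answering extension queries\<close>

text \<open>With truncated subtraction \<open>e - d\<close> is nonzero iff \<open>d < e\<close>, and
  \<open>1 - (1 - x)\<close> turns any nonzero \<open>x\<close> into 1.\<close>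

definition less_expr :: "expr \<Rightarrow> expr \<Rightarrow> expr" where
  "less_expr d e = Op Sub (Const 1) (Op Sub (Const 1) (Op Sub e d))"

text \<open>One of the two truncated differences is always 0, so their sum is the distance.\<close>

definition eq_expr :: "expr \<Rightarrow> expr \<Rightarrow> expr" where
  "eq_expr d e = Op Sub (Const 1) (Op Add (Op Sub d e) (Op Sub e d))"

definition mod_expr :: "expr \<Rightarrow> expr \<Rightarrow> expr" where
  "mod_expr d e = Op Sub d (Op Mul (Op Div d e) e)"

lemma eval_less_expr [simp]: "eval (less_expr d e) s = of_bool (eval d s < eval e s)"
  and eval_eq_expr [simp]: "eval (eq_expr d e) s = of_bool (eval d s = eval e s)"
  and eval_mod_expr [simp]: "eval (mod_expr d e) s = eval d s mod eval e s"
  by (simp_all add: less_expr_def eq_expr_def mod_expr_def minus_div_mult_eq_mod)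

lemma leaves_small_less_expr [simp]:
    "leaves_small W (less_expr d e) s \<longleftrightarrow> 1 \<le> W \<and> leaves_small W d s \<and> leaves_small W e s"
  and leaves_small_eq_expr [simp]:
    "leaves_small W (eq_expr d e) s \<longleftrightarrow> 1 \<le> W \<and> leaves_small W d s \<and> leaves_small W e s"
  and leaves_small_mod_expr [simp]:
    "leaves_small W (mod_expr d e) s \<longleftrightarrow> leaves_small W d s \<and> leaves_small W e s"
  by (auto simp: less_expr_def eq_expr_def mod_expr_def)

definition frame :: "nat set \<Rightarrow> nat set \<Rightarrow> state \<Rightarrow> state \<Rightarrow> bool" where
  "frame X A s s' \<longleftrightarrow>
    (\<forall>x. x \<notin> X \<longrightarrow> var s' x = var s x) \<and> (\<forall>a. a \<notin> A \<longrightarrow> arr s' a = arr s a)"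

lemma frame_refl [simp]: "frame X A s s"
  by (simp add: frame_def)

lemma frame_set_var: "x \<in> X \<Longrightarrow> frame X A s s' \<Longrightarrow> frame X A s (set_var x v s')"
  by (auto simp: frame_def)

lemma frame_set_arr: "a \<in> A \<Longrightarrow> frame X A s s' \<Longrightarrow> frame X A s (set_arr a i v s')"
  by (auto simp: frame_def)

lemma frame_var: "frame X A s s' \<Longrightarrow> x \<notin> X \<Longrightarrow> var s' x = var s x"
  and frame_arr: "frame X A s s' \<Longrightarrow> a \<notin> A \<Longrightarrow> arr s' a = arr s a"
  by (simp_all add: frame_def)

text \<open>
  A program using only names up to \<open>N\<close> leaves the following ones free.  The offsets start at 3
  because the simplifier would turn \<open>N + 1\<close> and \<open>N + 2\<close> into successors.
\<close>

abbreviation (input) "vn N \<equiv> N + 3 :: nat"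
abbreviation (input) "vK N \<equiv> N + 4 :: nat"
abbreviation (input) "vq N \<equiv> N + 5 :: nat"
abbreviation (input) "vt N \<equiv> N + 6 :: nat"
abbreviation (input) "vok N \<equiv> N + 7 :: nat"
abbreviation (input) "vj N \<equiv> N + 8 :: nat"
abbreviation (input) "vl N \<equiv> N + 9 :: nat"
abbreviation (input) "vS N \<equiv> N + 10 :: nat"
abbreviation (input) "aX N \<equiv> N + 3 :: nat"
abbreviation (input) "aF N \<equiv> N + 4 :: nat"
abbreviation (input) "aD N \<equiv> N + 5 :: nat"

text \<open>Marks of earlier calls must go. Only the marks of genuine coordinates are cleared: an
  out-of-range query may leave others behind, but \<open>fill_table\<close> never reads
  those.\<close>

definition clear_marks :: "nat \<Rightarrow> prog" where
  "clear_marks N = Store (aF N) (Var (vl N)) (Const 0)"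

definition record_marks :: "nat \<Rightarrow> nat \<Rightarrow> nat \<Rightarrow> prog" where
  "record_marks N a b = Seq
    (Assign (vok N) (Op Mul (Var (vok N))
      (Op Mul (less_expr (Arr a (Var (vl N))) (Var (vn N)))
        (less_expr (Arr b (Var (vl N))) (Const 2)))))
    (Store (aF N) (Op Add (Op Mul (Const 2) (Arr a (Var (vl N)))) (Arr b (Var (vl N)))) (Const 1))"

text \<open>
  Entry \<open>iq + r\<close> of the table says whether residue \<open>t\<close> can be reached from the partial sum \<open>r\<close> with the
  items from \<open>i\<close> on.  It depends on row \<open>i + 1\<close> only, so counting down is the right order.
\<close>

definition fill_table :: "nat \<Rightarrow> prog" where
  "fill_table N = (let i = Op Div (Var (vl N)) (Var (vq N)); r = mod_expr (Var (vl N)) (Var (vq N)) in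
    If (less_expr (Var (vl N)) (Op Mul (Var (vn N)) (Var (vq N))))
      (Store (aD N) (Var (vl N)) (less_expr (Const 0) (Op Add
        (Op Mul (Op Sub (Const 1) (Arr (aF N) (Op Add (Op Mul (Const 2) i) (Const 1))))
          (Arr (aD N) (Op Add (Var (vl N)) (Var (vq N)))))
        (Op Mul (Op Sub (Const 1) (Arr (aF N) (Op Mul (Const 2) i)))
          (Arr (aD N) (Op Add (Op Mul (Op Add i (Const 1)) (Var (vq N)))
            (mod_expr (Op Add r (Arr (aX N) (Op Add i (Const 1)))) (Var (vq N)))))))))
      (Store (aD N) (Var (vl N)) (eq_expr r (Var (vt N)))))"

text \<open>Round bounds; with the loop overhead 12 they yield the constants 22, 112 and 512
  below.\<close>

lemma pweight_clear_marks: "pweight (clear_marks N) \<le> 10"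
  and pweight_record_marks: "pweight (record_marks N a b) \<le> 100"
  and pweight_fill_table: "pweight (fill_table N) \<le> 500"
  by (simp_all add: clear_marks_def record_marks_def fill_table_def less_expr_def eq_expr_def
      mod_expr_def Let_def)

lemma bits_le_1: "x \<le> 1 \<Longrightarrow> bits x = 1"
  using bits_mono[of x 1] bits_pos[of x] by (simp del: bits_pos)

lemma runs_clear_marks:
  assumes "var s (vl N) = k" and "\<forall>i. arr s (aF N) i \<le> 1" and W: "Suc k \<le> W"
  shows "runs Q (Countdown (vl N) (clear_marks N)) s (2 + k * (22 * W))
    (\<lambda>s'. frame {vl N} {aF N} s s' \<and> (\<forall>i. arr s' (aF N) i \<le> 1) \<and> (\<forall>i<k. arr s' (aF N) i = 0))"
proof -
  define I where "I m s' \<longleftrightarrow> frame {vl N} {aF N} s s' \<and> (\<forall>i. arr s' (aF N) i \<le> 1) \<and>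
    (\<forall>i. m \<le> i \<and> i < k \<longrightarrow> arr s' (aF N) i = 0)" for m s'
  have "runs Q (Countdown (vl N) (clear_marks N)) s (2 + k * ((pweight (clear_marks N) + 12) * W))
      (\<lambda>s'. I 0 s' \<and> var s' (vl N) = 0)"
  proof (rule runs_Countdown_uniform)
    show "I k s" using assms by (simp add: I_def)
    show "var s (vl N) = k" by fact
    show "bits k \<le> W" using bits_le_Suc[of k] W by simp
    fix m s'
    assume "m < k" "I (Suc m) s'" "var s' (vl N) = Suc m"
    then show "wp W (clear_marks N) (\<lambda>s'. I m s' \<and> var s' (vl N) = m) (set_var (vl N) m s')"
      using W bits_le_Suc[of m]
      by (auto simp: clear_marks_def I_def frame_set_var frame_set_arr Suc_le_eq)
  qed
  then show ?thesis
    by (rule runs_mono) (use pweight_clear_marks[of N] in \<open>auto simp: I_def intro!: mult_le_mono\<close>)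
qed

text \<open>The given program chooses both the length and the entries of the query, so no bound in
  terms of \<open>W\<close> is possible. The sum in the budget is what \<open>exec\<close> charges
  for reading the query.\<close>

lemma runs_record_marks:
  assumes "var s (vl N) = k" and n: "var s (vn N) = n" and ok: "var s (vok N) = of_bool P"
    and F: "\<forall>i. arr s (aF N) i \<le> 1" "\<forall>i<d. arr s (aF N) i = 0"
    and N: "a \<le> N" "b \<le> N" and W: "bits n \<le> W" "2 \<le> W"
  shows "runs Q (Countdown (vl N) (record_marks N a b)) s
    (2 + 212 * W * (\<Sum>l<k. bits l + bits (arr s a l) + bits (arr s b l)))
    (\<lambda>s'. frame {vl N, vok N} {aF N} s s' \<and> (\<forall>i. arr s' (aF N) i \<le> 1) \<and>
      var s' (vok N) = of_bool (P \<and> (\<forall>l<k. arr s a l < n \<and> arr s b l < 2)) \<and>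
      (\<forall>i<d. arr s' (aF N) i = of_bool (i \<in> marks k (arr s a) (arr s b))))"
proof -
  define I where "I m s' \<longleftrightarrow> frame {vl N, vok N} {aF N} s s' \<and> (\<forall>i. arr s' (aF N) i \<le> 1) \<and>
    var s' (vok N) = of_bool (P \<and> (\<forall>l. m \<le> l \<and> l < k \<longrightarrow> arr s a l < n \<and> arr s b l < 2)) \<and>
    (\<forall>i<d. arr s' (aF N) i = of_bool (\<exists>l. m \<le> l \<and> l < k \<and> i = 2 * arr s a l + arr s b l))" for m s'
  define B where "B m = 100 * (W + bits m + bits (arr s a m) + bits (arr s b m))" for m
  have "runs Q (Countdown (vl N) (record_marks N a b)) s (2 + (\<Sum>m<k. B m + 12 * bits m))
      (\<lambda>s'. I 0 s' \<and> var s' (vl N) = 0)"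
  proof (rule runs_Countdown)
    show "I k s" using ok F by (auto simp: I_def)
    show "var s (vl N) = k" by fact
    fix m s'
    assume m: "m < k" and I: "I (Suc m) s'"
    \<comment> \<open>A word size for this round only, made of \<open>W\<close> and the entries read
      in it.\<close>
    define V where "V = W + bits m + bits (arr s a m) + bits (arr s b m)"
    have fr: "frame {vl N, vok N} {aF N} s s'" using I by (simp add: I_def)
    have arrs: "arr s' a = arr s a" "arr s' b = arr s b"
      using N by (auto intro!: frame_arr[OF fr])
    have n': "var s' (vn N) = n" using frame_var[OF fr, of "vn N"] n by simp
    have ok': "var s' (vok N) =
        of_bool (P \<and> (\<forall>l. Suc m \<le> l \<and> l < k \<longrightarrow> arr s a l < n \<and> arr s b l < 2))"
      using I by (simp add: I_def)
    have all: "(\<forall>l. m \<le> l \<and> l < k \<longrightarrow> R l) \<longleftrightarrow> R m \<and> (\<forall>l. Suc m \<le> l \<and> l < k \<longrightarrow> R l)" for R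
      using m by (metis Suc_leD Suc_leI le_less order.refl)
    have ex: "(\<exists>l. m \<le> l \<and> l < k \<and> R l) \<longleftrightarrow> R m \<or> (\<exists>l. Suc m \<le> l \<and> l < k \<and> R l)" for R
      using all[of "\<lambda>l. \<not> R l"] by blast
    have "I m (set_arr (aF N) (2 * arr s a m + arr s b m) 1 (set_var (vok N)
        (var s' (vok N) * (of_bool (arr s a m < n) * of_bool (arr s b m < 2))) (set_var (vl N) m s')))"
      using I fr unfolding I_def ok' all ex
      by (auto simp: frame_set_var frame_set_arr)
    then have "wp V (record_marks N a b) (\<lambda>s'. I m s' \<and> var s' (vl N) = m) (set_var (vl N) m s')"
      using N W arrs n' ok' by (simp add: record_marks_def V_def bits_le_1)
    then have "runs Q (record_marks N a b) (set_var (vl N) m s') (pweight (record_marks N a b) * V)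
        (\<lambda>s'. I m s' \<and> var s' (vl N) = m)"
      using W by (intro runs_wp) (simp_all add: V_def)
    then show "runs Q (record_marks N a b) (set_var (vl N) m s') (B m)
        (\<lambda>s'. I m s' \<and> var s' (vl N) = m)"
      using mult_le_mono1[OF pweight_record_marks[of N a b], of V]
      unfolding B_def V_def[symmetric] by (rule runs_mono)
  qed
  moreover have "(\<Sum>m<k. B m + 12 * bits m) \<le>
      212 * W * (\<Sum>l<k. bits l + bits (arr s a l) + bits (arr s b l))"
    unfolding sum_distrib_left
  proof (rule sum_mono)
    fix m
    define v where "v = bits m + bits (arr s a m) + bits (arr s b m)"
    have "1 \<le> v" using bits_pos[of m] unfolding v_def by linarith
    then have "W \<le> W * v" "v \<le> W * v" using W by simp_all
    moreover have "B m + 12 * bits m \<le> 100 * W + 112 * v" by (simp add: B_def v_def)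
    ultimately show "B m + 12 * bits m \<le> 212 * W * (bits m + bits (arr s a m) + bits (arr s b m))"
      unfolding v_def[symmetric] by linarith
  qed
  ultimately show ?thesis
    by (elim runs_mono) (auto simp: I_def marks_def)
qed

lemma runs_fill_table:
  assumes vars: "var s (vq N) = q" "var s (vn N) = length xs" "var s (vt N) = t mod q"
      "var s (vl N) = Suc (length xs) * q"
    and "0 < q"
    and X: "\<forall>i<length xs. arr s (aX N) (Suc i) = xs ! i"
    and F: "\<forall>i<2 * length xs. arr s (aF N) i = of_bool (i \<in> M)"
    and small: "\<forall>i. bits (arr s (aX N) i) \<le> W" "\<forall>i. arr s (aF N) i \<le> 1" "\<forall>i. arr s (aD N) i \<le> 1"
    and W: "Suc (Suc (length xs) * q) \<le> W"
  shows "runs Q (Countdown (vl N) (fill_table N)) s (2 + Suc (length xs) * q * (512 * W))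
    (\<lambda>s'. frame {vl N} {aD N} s s' \<and> (\<forall>i. arr s' (aD N) i \<le> 1) \<and>
      arr s' (aD N) 0 = of_bool (reaches t xs q (allowed M) 0 0))"
proof -
  define n where "n = length xs"
  define G where "G idx = reaches t xs q (allowed M) (idx div q) (idx mod q)" for idx
  define I where "I m s' \<longleftrightarrow> frame {vl N} {aD N} s s' \<and> (\<forall>i. arr s' (aD N) i \<le> 1) \<and>
    (\<forall>idx. m \<le> idx \<and> idx < Suc n * q \<longrightarrow> arr s' (aD N) idx = of_bool (G idx))" for m s'
  have small_number: "bits x \<le> W" if "x \<le> Suc n * q" for x
    using bits_le_Suc[of x] that W unfolding n_def by linarith
  have "2 \<le> W" using W \<open>0 < q\<close> by (cases q) simp_all
  have "runs Q (Countdown (vl N) (fill_table N)) s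
      (2 + Suc n * q * ((pweight (fill_table N) + 12) * W)) (\<lambda>s'. I 0 s' \<and> var s' (vl N) = 0)"
  proof (rule runs_Countdown_uniform)
    show "I (Suc n * q) s" using small by (simp add: I_def)
    show "var s (vl N) = Suc n * q" unfolding n_def by fact
    show "bits (Suc n * q) \<le> W" by (simp only: small_number)
    fix m s'
    assume m: "m < Suc n * q" and I: "I (Suc m) s'"
    define i r where "i = m div q" and "r = m mod q"
    have fr: "frame {vl N} {aD N} s s'" using I by (simp add: I_def)
    have vars': "var s' (vq N) = q" "var s' (vn N) = n" "var s' (vt N) = t mod q"
      using vars frame_var[OF fr] by (simp_all add: n_def)
    have arrs': "arr s' (aX N) = arr s (aX N)" "arr s' (aF N) = arr s (aF N)"
      using frame_arr[OF fr] by simp_all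
    have "n \<le> n * q" using \<open>0 < q\<close> by simp
    then have "bits n \<le> W" by (intro small_number) (simp only: mult_Suc trans_le_add2)
    then have bnd: "bits m \<le> W" "bits q \<le> W" "bits n \<le> W" "bits (t mod q) \<le> W"
      using m mod_less_divisor[OF \<open>0 < q\<close>, of t] by (simp_all add: small_number)
    have D: "arr s' (aD N) idx = of_bool (G idx)" if "m < idx" "idx < Suc n * q" for idx
      using I that by (simp add: I_def Suc_le_eq)
    have step: "I m (set_arr (aD N) m (of_bool (G m)) (set_var (vl N) m s'))"
      using I fr by (auto simp: I_def frame_set_var frame_set_arr Suc_le_eq)
    have bit: "bits (arr s' (aD N) idx) \<le> W" "bits (arr s (aF N) idx) \<le> W" for idx
      using I small \<open>2 \<le> W\<close> by (simp_all add: I_def bits_le_1)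
    show "wp W (fill_table N) (\<lambda>s'. I m s' \<and> var s' (vl N) = m) (set_var (vl N) m s')"
    proof (cases "m < n * q")
      case True
      then have i: "i < n" unfolding i_def using \<open>0 < q\<close> by (simp add: less_mult_imp_div_less)
      have "m + q < Suc n * q" using True by simp
      \<comment> \<open>Item \<open>i\<close> is left out: the same residue one row further
        on.\<close>
      then have D1: "arr s' (aD N) (m + q) = of_bool (reaches t xs q (allowed M) (Suc i) r)"
        using D[of "m + q"] \<open>0 < q\<close> unfolding G_def i_def r_def by simp
      \<comment> \<open>Item \<open>i\<close> is taken: the new residue in row \<open>Suc i\<close>.
        Whatever that residue is, the cell lies beyond \<open>m\<close> and is already
        filled.\<close>
      define idx where "idx = Suc i * q + (r + xs ! i) mod q"
      have idx: "idx div q = Suc i" "idx mod q = (r + xs ! i) mod q"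
        using \<open>0 < q\<close> unfolding idx_def by (simp_all del: mult_Suc)
      have "m = i * q + r" unfolding i_def r_def by simp
      moreover have "r < q" unfolding r_def using \<open>0 < q\<close> by simp
      ultimately have "m < idx" unfolding idx_def by simp
      moreover have "idx < Suc n * q"
        using idx(1) i \<open>0 < q\<close> by (metis Suc_less_eq less_mult_imp_div_less div_less_iff_less_mult)
      ultimately have D2: "arr s' (aD N) idx = of_bool (reaches t xs q (allowed M) (Suc i) (r + xs ! i))"
        using D[of idx] unfolding G_def idx by (simp add: reaches_mod)
      have "G m \<longleftrightarrow> 2 * i + 1 \<notin> M \<and> reaches t xs q (allowed M) (Suc i) r \<or>
          2 * i \<notin> M \<and> reaches t xs q (allowed M) (Suc i) (r + xs ! i)"
        unfolding G_def using reaches_step[of i xs t q "allowed M" r] i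
        by (simp add: i_def r_def n_def allowed_def)
      then have val: "of_bool (0 < (1 - arr s (aF N) (2 * i + 1)) * arr s' (aD N) (m + q) +
          (1 - arr s (aF N) (2 * i)) * arr s' (aD N) idx) = (of_bool (G m) :: nat)"
        unfolding D1 D2 using F i by (simp add: n_def)
      have "arr s (aX N) (Suc i) = xs ! i" using X i by (simp add: n_def)
      moreover from this have "bits (xs ! i) \<le> W" using small(1) by metis
      ultimately show ?thesis
        using True val step bit bnd small(1) vars' arrs' \<open>2 \<le> W\<close>
        by (simp add: fill_table_def Let_def idx_def flip: i_def r_def)
    next
      case False
      \<comment> \<open>The last row, where no item is left and the residue itself must be that of
        the target.\<close>
      then have "m div q = n"
        using m \<open>0 < q\<close> by (simp add: div_nat_eqI mult.commute)
      then have "G m \<longleftrightarrow> r = t mod q" unfolding G_def r_def n_def by (simp add: reaches_end)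
      then show ?thesis using False step bnd vars' \<open>2 \<le> W\<close>
        by (simp add: fill_table_def Let_def flip: r_def)
    qed
  qed
  then show ?thesis
    by (rule runs_mono)
      (use pweight_fill_table[of N] \<open>0 < q\<close> in \<open>auto simp: I_def G_def n_def intro!: mult_le_mono\<close>)
qed

section \<open>Simulating the oracle\<close>

fun emax :: "expr \<Rightarrow> nat" where
  "emax (Const k) = 0"
| "emax (Var x) = x"
| "emax (Arr a e) = max a (emax e)"
| "emax (Op f d e) = max (emax d) (emax e)"

fun pmax :: "prog \<Rightarrow> nat" where
  "pmax Skip = 0"
| "pmax (Assign x e) = max x (emax e)"
| "pmax (Store a d e) = max a (max (emax d) (emax e))"
| "pmax (Seq p1 p2) = max (pmax p1) (pmax p2)"
| "pmax (If e p1 p2) = max (emax e) (max (pmax p1) (pmax p2))"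
| "pmax (While e p) = max (emax e) (pmax p)"
| "pmax (Ask x ej ek a b) = Max {x, emax ej, emax ek, a, b}"

abbreviation agree_upto :: "nat \<Rightarrow> state \<Rightarrow> state \<Rightarrow> bool" where
  "agree_upto N \<equiv> frame {N<..} {N<..}"

lemma eval_agree: "agree_upto N s u \<Longrightarrow> emax e \<le> N \<Longrightarrow> eval e u = eval e s"
  by (induction e) (simp_all add: frame_def)

lemma ecost_agree: "agree_upto N s u \<Longrightarrow> emax e \<le> N \<Longrightarrow> ecost e u = ecost e s"
  by (induction e) (simp_all add: frame_def eval_agree)

definition input_array :: "nat list \<Rightarrow> nat \<Rightarrow> nat" where
  "input_array ws i = (if i < length ws then ws ! i else 0)"

text \<open>What survives from one simulated call to the next. Marks and table cells hold leftovers,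
  so only their size is recorded, which keeps reading them cheap.\<close>

definition private_ok :: "nat \<Rightarrow> nat \<Rightarrow> nat list \<Rightarrow> nat \<Rightarrow> state \<Rightarrow> bool" where
  "private_ok N t xs K s \<longleftrightarrow> var s (vn N) = length xs \<and> var s (vK N) = K \<and>
    arr s (aX N) = input_array (t # xs) \<and> (\<forall>i. arr s (aF N) i \<le> 1) \<and> (\<forall>i. arr s (aD N) i \<le> 1)"

text \<open>If the constraint number is out of range, the modulus is set to 1 to keep the table small.\<close>

definition ask_setup :: "nat \<Rightarrow> prog" where
  "ask_setup N =
    Seq (Assign (vok N) (less_expr (Var (vj N)) (Var (vK N))))
    (Seq (Assign (vq N) (Op Add (Const 1) (Op Mul (Var (vj N)) (Var (vok N)))))
    (Seq (Assign (vt N) (mod_expr (Arr (aX N) (Const 0)) (Var (vq N))))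
    (Assign (vl N) (Op Mul (Const 2) (Var (vn N))))))"

definition ask_prog :: "nat \<Rightarrow> nat \<Rightarrow> expr \<Rightarrow> expr \<Rightarrow> nat \<Rightarrow> nat \<Rightarrow> prog" where
  "ask_prog N x ej ek a b =
    Seq (Assign (vj N) ej)
    (Seq (ask_setup N)
    (Seq (Countdown (vl N) (clear_marks N))
    (Seq (Assign (vl N) ek)
    (Seq (Countdown (vl N) (record_marks N a b))
    (Seq (Assign (vl N) (Op Mul (Op Add (Var (vn N)) (Const 1)) (Var (vq N))))
    (Seq (Countdown (vl N) (fill_table N))
    (Assign x (Op Mul (Var (vok N)) (Arr (aD N) (Const 0))))))))))"

lemma runs_Assign:
  "R (set_var x (eval e s) s) \<Longrightarrow> runs Q (Assign x e) s (1 + 2 * ecost e s) R"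
  using bits_eval_le_ecost[of e s] by (intro runsI[OF exec.Assign]) simp_all

text \<open>\<open>T\<close> is exactly the price of the oracle call. Clearing marks and filling the
  table take time of order \<open>W * W\<close>, and the work depending on the query is of order
  \<open>W * T\<close>, so a call is slowed down by a factor of order \<open>W * W\<close>.\<close>

lemma runs_ask_prog:
  fixes ej ek :: expr
  assumes priv: "private_ok N t xs K u"
    and names: "x \<le> N" "emax ek \<le> N" "a \<le> N" "b \<le> N"
    and W: "\<forall>i. bits (input_array (t # xs) i) \<le> W" "2 * (Suc (length xs) * Suc K) + 2 \<le> W"
  defines "j \<equiv> eval ej u" and "k \<equiv> eval ek u"
  defines "S \<equiv> (\<Sum>i<k. bits i + bits (arr u a i) + bits (arr u b i))"
  defines "T \<equiv> 1 + ecost ej u + ecost ek u + S"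
  defines "ans \<equiv> extension_oracle (congruence_instance t xs K) j (arr_prefix u a k) (arr_prefix u b k)"
  shows "runs Q (ask_prog N x ej ek a b) u (2000 * (W * W) * T)
    (\<lambda>u'. private_ok N t xs K u' \<and> agree_upto N (set_var x (of_bool ans) u) u')"
proof -
  define n where "n = length xs"
  define q where "q = Suc (j * of_bool (j < K))"
  define M where "M = marks k (arr u a) (arr u b)"
  define fits where "fits \<longleftrightarrow> j < K \<and> (\<forall>l<k. arr u a l < n \<and> arr u b l < 2)"
  have "0 < q" "q \<le> Suc K" by (simp_all add: q_def)
  have "Suc n * q \<le> Suc n * Suc K" using \<open>q \<le> Suc K\<close> by (rule mult_le_mono2)
  moreover have "Suc n \<le> Suc n * Suc K" "Suc K \<le> Suc n * Suc K" by simp_all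
  ultimately have small: "2 * n + 2 \<le> W" "Suc (Suc n * q) \<le> W" "q \<le> W" "Suc K \<le> W" "2 \<le> W"
    using W(2) \<open>q \<le> Suc K\<close> unfolding n_def[symmetric] by linarith+
  have bits_small: "bits i \<le> W" if "Suc i \<le> W" for i
    using bits_le_Suc[of i] that by simp
  have bits_W: "bits n \<le> W" "bits K \<le> W" "bits q \<le> W + T"
    using small bits_le_Suc[of q] by (auto intro!: bits_small simp: T_def)
  have "bits j \<le> T" using bits_eval_le_ecost[of ej u] by (simp add: j_def T_def)
  define R1 where "R1 s \<longleftrightarrow> s = set_var (vj N) j u" for s
  define R2 where "R2 s \<longleftrightarrow> frame {vj N, vok N, vq N, vt N, vl N} {} u s \<and>
    var s (vok N) = of_bool (j < K) \<and> var s (vq N) = q \<and> var s (vt N) = t mod q" for s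
  define R3 where "R3 s \<longleftrightarrow> frame {vj N, vok N, vq N, vt N, vl N} {aF N} u s \<and>
    var s (vok N) = of_bool (j < K) \<and> var s (vq N) = q \<and> var s (vt N) = t mod q \<and>
    (\<forall>i. arr s (aF N) i \<le> 1) \<and> (\<forall>i<2 * n. arr s (aF N) i = 0)" for s
  define R5 where "R5 s \<longleftrightarrow> frame {vj N, vok N, vq N, vt N, vl N} {aF N} u s \<and>
    var s (vok N) = of_bool fits \<and> var s (vq N) = q \<and> var s (vt N) = t mod q \<and>
    (\<forall>i. arr s (aF N) i \<le> 1) \<and> (\<forall>i<2 * n. arr s (aF N) i = of_bool (i \<in> M))" for s
  define R7 where "R7 s \<longleftrightarrow> frame {vj N, vok N, vq N, vt N, vl N} {aF N, aD N} u s \<and>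
    var s (vok N) = of_bool fits \<and> (\<forall>i. arr s (aF N) i \<le> 1) \<and> (\<forall>i. arr s (aD N) i \<le> 1) \<and>
    arr s (aD N) 0 = of_bool (reaches t xs q (allowed M) 0 0)" for s
  have 1: "runs Q (Assign (vj N) ej) u (1 + 2 * ecost ej u) R1"
    by (rule runs_Assign) (simp add: R1_def j_def)
  \<comment> \<open>The constraint number \<open>j\<close> may be huge; only the cost of computing
    it bounds its length, hence the word size \<open>W + T\<close>.\<close>
  have 2: "runs Q (ask_setup N) s (pweight (ask_setup N) * (W + T))
      (\<lambda>s'. R2 s' \<and> var s' (vl N) = 2 * n)" if "R1 s" for s
  proof (rule runs_wp)
    have "bits t \<le> W" using W(1)[rule_format, of 0] by (simp add: input_array_def)
    then show "wp (W + T) (ask_setup N) (\<lambda>s'. R2 s' \<and> var s' (vl N) = 2 * n) s"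
      using that bits_W \<open>bits j \<le> T\<close> priv small
      by (simp add: ask_setup_def R1_def R2_def private_ok_def input_array_def frame_def n_def
          trans_le_add1 trans_le_add2 bits_le_1 flip: q_def)
  qed (use small in simp)
  have 3: "runs Q (Countdown (vl N) (clear_marks N)) s (2 + 2 * n * (22 * W)) R3"
    if "R2 s \<and> var s (vl N) = 2 * n" for s
    by (rule runs_mono[OF runs_clear_marks[of s N "2 * n" W] order.refl])
      (use that priv small in \<open>auto simp: R2_def R3_def private_ok_def frame_def\<close>)
  have 4: "runs Q (Assign (vl N) ek) s (1 + 2 * ecost ek u) (\<lambda>s'. R3 s' \<and> var s' (vl N) = k)"
    if "R3 s" for s
  proof -
    \<comment> \<open>So far only private names have changed, so evaluating \<open>ek\<close> this
      late gives the value it had in \<open>u\<close>.\<close>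
    have "agree_upto N u s" using that by (auto simp: R3_def frame_def)
    then have "eval ek s = k" "ecost ek s = ecost ek u"
      using names by (simp_all add: eval_agree ecost_agree k_def)
    with runs_Assign[of "\<lambda>s'. R3 s' \<and> var s' (vl N) = k" "vl N" ek s Q] that show ?thesis
      by (simp add: R3_def frame_set_var)
  qed
  have 5: "runs Q (Countdown (vl N) (record_marks N a b)) s (2 + 212 * W * S) R5"
    if "R3 s \<and> var s (vl N) = k" for s
  proof -
    have "arr s a = arr u a" "arr s b = arr u b" "var s (vn N) = n"
      using that names priv by (auto simp: R3_def frame_def private_ok_def n_def)
    then show ?thesis
      by (intro runs_mono[OF runs_record_marks[of s N k n "j < K" "2 * n" a b W Q]])
        (use that names bits_W small in
          \<open>auto simp: R3_def R5_def fits_def M_def frame_def S_def\<close>)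
  qed
  have 6: "runs Q (Assign (vl N) (Op Mul (Op Add (Var (vn N)) (Const 1)) (Var (vq N)))) s (20 * (W + T))
      (\<lambda>s'. R5 s' \<and> var s' (vl N) = Suc n * q)" if "R5 s" for s
  proof -
    have "var s (vn N) = n" using that priv by (simp add: R5_def frame_def private_ok_def n_def)
    then have "wp (W + T) (Assign (vl N) (Op Mul (Op Add (Var (vn N)) (Const 1)) (Var (vq N))))
        (\<lambda>s'. R5 s' \<and> var s' (vl N) = Suc n * q) s"
      using that bits_W small by (simp add: R5_def frame_set_var trans_le_add1)
    from runs_wp[OF this] show ?thesis by (rule runs_mono) (use small in simp_all)
  qed
  have 7: "runs Q (Countdown (vl N) (fill_table N)) s (2 + Suc n * q * (512 * W)) R7"
    if "R5 s \<and> var s (vl N) = Suc n * q" for s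
    unfolding n_def
    by (rule runs_mono[OF runs_fill_table[where M = M and t = t and q = q] order.refl])
      (use that priv small \<open>0 < q\<close> W(1) in
        \<open>auto simp: R5_def R7_def private_ok_def frame_def n_def input_array_def\<close>)
  have ans: "ans \<longleftrightarrow> fits \<and> reaches t xs q (allowed M) 0 0"
    unfolding ans_def arr_prefix_def extension_oracle_congruence_instance
    by (auto simp: fits_def q_def M_def n_def)
  have 8: "runs Q (Assign x (Op Mul (Var (vok N)) (Arr (aD N) (Const 0)))) s (20 * W)
      (\<lambda>u'. private_ok N t xs K u' \<and> agree_upto N (set_var x (of_bool ans) u) u')" if "R7 s" for s
  proof -
    have "wp W (Assign x (Op Mul (Var (vok N)) (Arr (aD N) (Const 0))))
      (\<lambda>u'. private_ok N t xs K u' \<and> agree_upto N (set_var x (of_bool ans) u) u') s"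
      using that priv small names
      by (auto simp: R7_def frame_def private_ok_def ans bits_le_1)
    from runs_wp[OF this] show ?thesis by (rule runs_mono) (use small in simp_all)
  qed
  have weight: "pweight (ask_setup N) \<le> 100"
    by (simp add: ask_setup_def less_expr_def mod_expr_def)
  have "runs Q (ask_prog N x ej ek a b) u
     (1 + 2 * ecost ej u + (pweight (ask_setup N) * (W + T) + (2 + 2 * n * (22 * W) +
      (1 + 2 * ecost ek u + (2 + 212 * W * S + (20 * (W + T) +
      (2 + Suc n * q * (512 * W) + 20 * W)))))))
     (\<lambda>u'. private_ok N t xs K u' \<and> agree_upto N (set_var x (of_bool ans) u) u')"
    unfolding ask_prog_def
    by (rule runs_SeqI[OF 1], rule runs_SeqI[OF 2], assumption, rule runs_SeqI[OF 3], assumption,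
      rule runs_SeqI[OF 4], assumption, rule runs_SeqI[OF 5], assumption,
      rule runs_SeqI[OF 6], assumption, rule runs_SeqI[OF 7], assumption, rule 8)
  moreover have "1 + 2 * ecost ej u + (pweight (ask_setup N) * (W + T) + (2 + 2 * n * (22 * W) +
      (1 + 2 * ecost ek u + (2 + 212 * W * S + (20 * (W + T) +
      (2 + Suc n * q * (512 * W) + 20 * W)))))) \<le> 2000 * (W * W) * T"
  proof -
    \<comment> \<open>With \<open>Y\<close> for \<open>W * W * T\<close> each summand is a multiple
      of \<open>Y\<close>, and the estimate becomes linear; 2000 is a generous total.\<close>
    have sum_le: "1 + 2 * e + (w + (2 + p + (1 + 2 * e' + (2 + r + (20 * (W + T) + (2 + f + 20 * W))))))
        \<le> 2000 * Y"
      if "W \<le> Y" "T \<le> Y" "w \<le> 100 * (W + T)" "p \<le> 22 * Y" "r \<le> 212 * Y" "f \<le> 512 * Y"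
        "e \<le> T" "e' \<le> T" "1 \<le> Y" for e e' w p r f Y
      using that by simp
    define Y where "Y = W * W * T"
    have "1 \<le> T" "1 \<le> W" using small by (simp_all add: T_def)
    then have Y: "W * W \<le> Y" "W * T \<le> Y" unfolding Y_def by simp_all
    have "W \<le> W * W" "T \<le> W * T" using \<open>1 \<le> W\<close> by simp_all
    with Y have "W \<le> Y" "T \<le> Y" by linarith+
    moreover have "2 * n * (22 * W) \<le> 22 * Y"
      using mult_le_mono[of "2 * n" W "22 * W" "22 * W"] small(1) Y(1) by linarith
    moreover have "212 * W * S \<le> 212 * Y"
      using mult_le_mono[of "212 * W" "212 * W" S T] Y(2) by (simp add: T_def)
    moreover have "Suc n * q * (512 * W) \<le> 512 * Y"
      using mult_le_mono[of "Suc n * q" W "512 * W" "512 * W"] small(2) Y(1) by linarith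
    moreover have "ecost ej u \<le> T" "ecost ek u \<le> T" by (simp_all add: T_def)
    moreover have "1 \<le> Y" using \<open>T \<le> Y\<close> \<open>1 \<le> T\<close> by linarith
    ultimately show ?thesis
      using sum_le[OF _ _ mult_le_mono1[OF weight]] by (simp only: Y_def mult.assoc)
  qed
  ultimately show ?thesis by (rule runs_mono)
qed

fun translate :: "nat \<Rightarrow> prog \<Rightarrow> prog" where
  "translate N (Ask x ej ek a b) = ask_prog N x ej ek a b"
| "translate N (Seq p1 p2) = Seq (translate N p1) (translate N p2)"
| "translate N (If e p1 p2) = If e (translate N p1) (translate N p2)"
| "translate N (While e p) = While e (translate N p)"
| "translate N p = p"

lemma oracle_free_translate: "oracle_free (translate N p)"
  by (induction p)
    (simp_all add: ask_prog_def ask_setup_def Countdown_def clear_marks_def record_marks_def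
      fill_table_def Let_def)

lemma private_ok_set_var: "x \<le> N \<Longrightarrow> private_ok N t xs K u \<Longrightarrow> private_ok N t xs K (set_var x v u)"
  and private_ok_set_arr: "a \<le> N \<Longrightarrow> private_ok N t xs K u \<Longrightarrow> private_ok N t xs K (set_arr a i v u)"
  by (auto simp: private_ok_def)

lemma agree_upto_set_var: "agree_upto N s u \<Longrightarrow> agree_upto N (set_var x v s) (set_var x v u)"
  and agree_upto_set_arr: "agree_upto N s u \<Longrightarrow> agree_upto N (set_arr a i v s) (set_arr a i v u)"
  by (simp_all add: frame_def)

text \<open>Induction along the oracle run. Ordinary steps keep their cost and calls grow by a fixed
  factor; a multiplicative bound is additive over the steps, so it passes to the whole run.\<close>

lemma runs_translate:
  assumes "exec (extension_oracle (congruence_instance t xs K)) p s T s'"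
    and "pmax p \<le> N" "agree_upto N s u" "private_ok N t xs K u"
    and W: "\<forall>i. bits (input_array (t # xs) i) \<le> W" "2 * (Suc (length xs) * Suc K) + 2 \<le> W"
  shows "runs Q (translate N p) u (2000 * (W * W) * T)
    (\<lambda>u'. agree_upto N s' u' \<and> private_ok N t xs K u')"
  using assms(1-4)
proof (induction arbitrary: u)
  define P where "P = 2000 * (W * W)"
  have "1 \<le> W" using W(2) by simp
  then have P: "x \<le> P * x" for x by (simp add: P_def)
  {
    case (Skip s)
    then show ?case unfolding P_def[symmetric]
      using P[of 1] by (auto intro!: runsI[OF exec.Skip])
  next
    case (Assign x e s)
    then show ?case unfolding P_def[symmetric] translate.simps
      by (intro runsI[OF exec.Assign])
        (simp_all add: eval_agree ecost_agree P agree_upto_set_var private_ok_set_var del: One_nat_def)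
  next
    case (Store a d e s)
    then show ?case unfolding P_def[symmetric] translate.simps
      by (intro runsI[OF exec.Store])
        (simp_all add: eval_agree ecost_agree P agree_upto_set_arr private_ok_set_arr del: One_nat_def)
  next
    case (Seq p1 s T1 s1 p2 T2 s2)
    show ?case unfolding translate.simps distrib_left
      by (rule runs_SeqI[OF Seq.IH(1)], use Seq.prems in simp_all)
        (rule Seq.IH(2), use Seq.prems in simp_all)
  next
    case (IfTrue e s p1 T s' p2)
    then have "runs Q (translate N p1) u (P * T) (\<lambda>u'. agree_upto N s' u' \<and> private_ok N t xs K u')"
      unfolding P_def by simp
    then obtain T' u' where "exec Q (translate N p1) u T' u'" "T' \<le> P * T"
      "agree_upto N s' u' \<and> private_ok N t xs K u'"
      unfolding runs_def by blast
    with IfTrue P[of "1 + ecost e s"] show ?case unfolding P_def[symmetric] translate.simps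
      by (intro runsI[OF exec.IfTrue]) (auto simp: eval_agree ecost_agree distrib_left)
  next
    case (IfFalse e s p2 T s' p1)
    then have "runs Q (translate N p2) u (P * T) (\<lambda>u'. agree_upto N s' u' \<and> private_ok N t xs K u')"
      unfolding P_def by simp
    then obtain T' u' where "exec Q (translate N p2) u T' u'" "T' \<le> P * T"
      "agree_upto N s' u' \<and> private_ok N t xs K u'"
      unfolding runs_def by blast
    with IfFalse P[of "1 + ecost e s"] show ?case unfolding P_def[symmetric] translate.simps
      by (intro runsI[OF exec.IfFalse]) (auto simp: eval_agree ecost_agree distrib_left)
  next
    case (WhileFalse e s p)
    with P[of "1 + ecost e s"] show ?case unfolding P_def[symmetric] translate.simps
      by (intro runsI[OF exec.WhileFalse]) (auto simp: eval_agree ecost_agree)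
  next
    case (WhileTrue e s p T1 s1 T2 s2)
    have "runs Q (translate N p) u (P * T1) (\<lambda>u'. agree_upto N s1 u' \<and> private_ok N t xs K u')"
      unfolding P_def using WhileTrue.prems by (intro WhileTrue.IH(1)) simp_all
    then obtain T1' u1 where 1: "exec Q (translate N p) u T1' u1" "T1' \<le> P * T1"
      "agree_upto N s1 u1" "private_ok N t xs K u1"
      unfolding runs_def by blast
    have "runs Q (translate N (While e p)) u1 (P * T2)
        (\<lambda>u'. agree_upto N s2 u' \<and> private_ok N t xs K u')"
      unfolding P_def using WhileTrue.prems(1) 1(3,4) by (rule WhileTrue.IH(2))
    then obtain T2' u2 where 2: "exec Q (While e (translate N p)) u1 T2' u2" "T2' \<le> P * T2"
      "agree_upto N s2 u2" "private_ok N t xs K u2"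
      unfolding runs_def by auto
    have e: "eval e u = eval e s" "ecost e u = ecost e s"
      using WhileTrue.prems by (simp_all add: eval_agree ecost_agree)
    show ?case unfolding P_def[symmetric] translate.simps
      by (rule runsI[OF exec.WhileTrue[OF _ 1(1) 2(1)]])
        (use WhileTrue.hyps(1) e 1 2 P[of "1 + ecost e s"] in \<open>auto simp: distrib_left\<close>)
  next
    case (Ask x ej ek a b s)
    then have names: "x \<le> N" "emax ej \<le> N" "emax ek \<le> N" "a \<le> N" "b \<le> N" by simp_all
    have e: "eval ej u = eval ej s" "ecost ej u = ecost ej s" "eval ek u = eval ek s"
        "ecost ek u = ecost ek s" "arr u a = arr s a" "arr u b = arr s b"
      using Ask.prems names by (simp_all add: eval_agree ecost_agree frame_arr)
    have pre: "arr_prefix u a l = arr_prefix s a l" "arr_prefix u b l = arr_prefix s b l" for l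
      using e by (simp_all add: arr_prefix_def)
    show ?case unfolding translate.simps
      by (rule runs_mono[OF runs_ask_prog[OF Ask.prems(3) names(1,3-5) W]])
        (use Ask.prems(2) in \<open>auto simp: e pre frame_def\<close>)
  }
qed

section \<open>Writing down the satisfiability instance\<close>

text \<open>The number of rounds of the halving loop, which differs from \<open>bits\<close> at 0
  only.\<close>

definition halvings :: "nat \<Rightarrow> nat" where
  "halvings v = (if v = 0 then 0 else bits v)"

lemma less_two_power_halvings: "v < 2 ^ halvings v"
  using less_two_power_bits by (simp add: halvings_def)

lemma halvings_half: "0 < v \<Longrightarrow> halvings v = Suc (halvings (v div 2))"
  using floor_log_rec[of v] by (cases "v = 1") (auto simp: halvings_def bits_def)

lemma halvings_le_bits: "halvings v \<le> bits v"
  by (simp add: halvings_def)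

text \<open>The input must be moved because array 0 will hold the encoded instance; the same pass
  adds up target and items.\<close>

definition copy_input :: "nat \<Rightarrow> prog" where
  "copy_input N = Seq (Store (aX N) (Var (vl N)) (Arr 0 (Var (vl N))))
    (Assign (vS N) (Op Add (Var (vS N)) (Arr 0 (Var (vl N)))))"

text \<open>Measures the bit length of the sum without a logarithm; two moduli per bit match the
  requirement \<open>2 * k \<le> K\<close>.\<close>

definition halve :: "nat \<Rightarrow> prog" where
  "halve N = Seq (Assign (vS N) (Op Div (Var (vS N)) (Const 2)))
    (Assign (vK N) (Op Add (Var (vK N)) (Const 2)))"

text \<open>A branch-free case distinction by truncated subtraction: for residue 0 only the scope
  length \<open>n\<close> survives, otherwise only the variable number.\<close>

definition write_scopes :: "nat \<Rightarrow> prog" where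
  "write_scopes N = (let m = mod_expr (Var (vl N)) (Op Add (Var (vn N)) (Const 1)) in
    Store 0 (Op Add (Var (vl N)) (Const 2))
      (Op Add (Op Sub m (Const 1)) (Op Mul (Var (vn N)) (Op Sub (Const 1) m))))"

definition prepare_start :: "nat \<Rightarrow> prog" where
  "prepare_start N = Seq (Assign (vn N) (Op Sub (Var 0) (Const 1)))
    (Seq (Assign (vK N) (Const 2)) (Assign (vl N) (Var 0)))"

definition prepare_end :: "nat \<Rightarrow> prog" where
  "prepare_end N = Seq (Store 0 (Const 0) (Var (vn N))) (Seq (Store 0 (Const 1) (Var (vK N)))
    (Assign 0 (Op Add (Const 2) (Op Mul (Var (vK N)) (Op Add (Var (vn N)) (Const 1))))))"

definition prepare :: "nat \<Rightarrow> prog" where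
  "prepare N =
    Seq (prepare_start N)
    (Seq (Countdown (vl N) (copy_input N))
    (Seq (While (Var (vS N)) (halve N))
    (Seq (Assign (vl N) (Op Mul (Var (vK N)) (Op Add (Var (vn N)) (Const 1))))
    (Seq (Countdown (vl N) (write_scopes N))
    (prepare_end N)))))"

lemma oracle_free_prepare: "oracle_free (prepare N)"
  by (simp add: prepare_def prepare_start_def prepare_end_def copy_input_def halve_def
      write_scopes_def Countdown_def Let_def)

lemma runs_copy_input:
  assumes "var s (vl N) = length ws" "var s (vS N) = 0"
    and s: "arr s 0 = input_array ws" "arr s (aX N) = (\<lambda>_. 0)"
    and W: "bits (length ws) \<le> W" "bits (sum_list ws) \<le> W"
  shows "runs Q (Countdown (vl N) (copy_input N)) s (2 + length ws * (32 * W))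
    (\<lambda>s'. frame {vl N, vS N} {aX N} s s' \<and> arr s' (aX N) = input_array ws \<and>
      var s' (vS N) = sum_list ws)"
proof -
  define I where "I m s' \<longleftrightarrow> frame {vl N, vS N} {aX N} s s' \<and>
    (\<forall>i. arr s' (aX N) i = (if m \<le> i then input_array ws i else 0)) \<and>
    var s' (vS N) = sum ((!) ws) {m..<length ws}" for m s'
  have sum_le: "sum ((!) ws) {m..<length ws} \<le> sum_list ws" for m
    unfolding sum_list_sum_nth by (intro sum_mono2) auto
  have "runs Q (Countdown (vl N) (copy_input N)) s (2 + length ws * ((pweight (copy_input N) + 12) * W))
      (\<lambda>s'. I 0 s' \<and> var s' (vl N) = 0)"
  proof (rule runs_Countdown_uniform)
    show "I (length ws) s" using assms by (auto simp: I_def input_array_def)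
    fix m s'
    assume m: "m < length ws" and I: "I (Suc m) s'"
    have "sum ((!) ws) {m..<length ws} = sum ((!) ws) {Suc m..<length ws} + ws ! m"
      using m by (simp add: sum.atLeast_Suc_lessThan)
    moreover have "arr s' 0 = input_array ws" using I s by (simp add: I_def frame_def)
    moreover have "bits m \<le> W" using W(1) bits_mono[of m "length ws"] m by simp
    moreover have "bits (ws ! m) \<le> W"
      using W(2) bits_mono[OF elem_le_sum_list[OF m]] by simp
    moreover have "bits (var s' (vS N)) \<le> W"
      using I W(2) bits_mono[OF sum_le[of "Suc m"]] by (simp add: I_def)
    ultimately show "wp W (copy_input N) (\<lambda>s'. I m s' \<and> var s' (vl N) = m) (set_var (vl N) m s')"
      using I m by (auto simp: copy_input_def I_def input_array_def frame_set_var frame_set_arr)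
  qed (use assms in auto)
  then show ?thesis
    by (rule runs_mono)
      (auto simp: I_def copy_input_def sum_list_sum_nth intro!: mult_le_mono)
qed

lemma runs_halve:
  assumes "var s (vS N) = v" "bits v \<le> W" "2 \<le> W" "Suc (var s (vK N) + 2 * halvings v) \<le> W"
  shows "runs Q (While (Var (vS N)) (halve N)) s (2 + halvings v * (20 * W))
    (\<lambda>s'. frame {vS N, vK N} {} s s' \<and> var s' (vK N) = var s (vK N) + 2 * halvings v)"
  using assms
proof (induction v arbitrary: s rule: less_induct)
  case (less v)
  show ?case
  proof (cases "v = 0")
    case True
    then show ?thesis using less.prems
      by (intro runsI[OF exec.WhileFalse]) (simp_all add: halvings_def)
  next
    case False
    define R where "R s1 \<longleftrightarrow> frame {vS N, vK N} {} s s1 \<and>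
      var s1 (vS N) = v div 2 \<and> var s1 (vK N) = var s (vK N) + 2" for s1
    have half: "halvings v = Suc (halvings (v div 2))" using False halvings_half by simp
    have "bits (v div 2) \<le> W" using less.prems(2) bits_mono[of "v div 2" v] by simp
    have "bits (var s (vK N)) \<le> W"
      using less.prems(4) bits_le_Suc[of "var s (vK N)"] by simp
    then have "wp W (halve N) R s"
      using less.prems by (simp add: halve_def R_def frame_set_var)
    from runs_wp[OF this] have 1: "runs Q (halve N) s (pweight (halve N) * W) R"
      using less.prems by simp
    have "runs Q (While (Var (vS N)) (halve N)) s
        (1 + ecost (Var (vS N)) s + pweight (halve N) * W + (2 + halvings (v div 2) * (20 * W)))
        (\<lambda>s'. frame {vS N, vK N} {} s s' \<and> var s' (vK N) = var s (vK N) + 2 * halvings v)"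
    proof (rule runs_While[OF _ 1])
      show "eval (Var (vS N)) s \<noteq> 0" using False less.prems by simp
      fix s1
      assume s1: "R s1"
      have "runs Q (While (Var (vS N)) (halve N)) s1 (2 + halvings (v div 2) * (20 * W))
        (\<lambda>s'. frame {vS N, vK N} {} s1 s' \<and> var s' (vK N) = var s1 (vK N) + 2 * halvings (v div 2))"
        using s1 False less.prems \<open>bits (v div 2) \<le> W\<close> half
        by (intro less.IH) (simp_all add: R_def)
      then show "runs Q (While (Var (vS N)) (halve N)) s1 (2 + halvings (v div 2) * (20 * W))
        (\<lambda>s'. frame {vS N, vK N} {} s s' \<and> var s' (vK N) = var s (vK N) + 2 * halvings v)"
        by (rule runs_mono) (use s1 half in \<open>auto simp: R_def frame_def\<close>)
    qed
    then show ?thesis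
      by (rule runs_mono) (use less.prems half in \<open>simp_all add: halve_def\<close>)
  qed
qed

lemma runs_write_scopes:
  assumes "var s (vl N) = K * Suc (length xs)" "var s (vn N) = length xs"
    and W: "Suc (K * Suc (length xs)) \<le> W" "Suc (length xs) \<le> W" "2 \<le> W"
  shows "runs Q (Countdown (vl N) (write_scopes N)) s (2 + K * Suc (length xs) * (130 * W))
    (\<lambda>s'. frame {vl N} {0} s s' \<and> (\<forall>i. arr s' 0 i =
      (if 2 \<le> i \<and> i < 2 + K * Suc (length xs) then encode_sat (congruence_instance t xs K) ! i
       else arr s 0 i)))"
proof -
  define L where "L = K * Suc (length xs)"
  define I where "I m s' \<longleftrightarrow> frame {vl N} {0} s s' \<and> (\<forall>i. arr s' 0 i =
    (if m + 2 \<le> i \<and> i < 2 + L then encode_sat (congruence_instance t xs K) ! i else arr s 0 i))"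
    for m s'
  have "runs Q (Countdown (vl N) (write_scopes N)) s (2 + L * ((pweight (write_scopes N) + 12) * W))
      (\<lambda>s'. I 0 s' \<and> var s' (vl N) = 0)"
  proof (rule runs_Countdown_uniform)
    show "I L s" by (simp add: I_def)
    show "var s (vl N) = L" using assms by (simp add: L_def)
    show "bits L \<le> W" using W bits_le_Suc[of L] by (simp add: L_def)
    fix m s'
    assume m: "m < L" and I: "I (Suc m) s'"
    define r where "r = m mod Suc (length xs)"
    have "var s' (vn N) = length xs" using I assms by (simp add: I_def frame_def)
    moreover have "bits m \<le> W" using bits_le_Suc[of m] W m by (simp add: L_def)
    moreover have "bits (length xs) \<le> W" using bits_le_Suc[of "length xs"] W by simp
    moreover have "encode_sat (congruence_instance t xs K) ! Suc (Suc m) =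
        r - Suc 0 + length xs * (Suc 0 - r)"
      using nth_encode_congruence_instance[of m K xs t] m by (auto simp: L_def r_def)
    moreover have "m + 2 \<le> i \<and> i < 2 + L \<longleftrightarrow> i = Suc (Suc m) \<or> Suc m + 2 \<le> i \<and> i < 2 + L" for i
      using m by auto
    ultimately show "wp W (write_scopes N) (\<lambda>s'. I m s' \<and> var s' (vl N) = m) (set_var (vl N) m s')"
      using I W by (simp add: write_scopes_def Let_def I_def frame_set_var frame_set_arr flip: r_def)
  qed
  then show ?thesis
    unfolding L_def[symmetric]
    by (rule runs_mono)
      (auto simp: I_def write_scopes_def Let_def mod_expr_def intro!: mult_le_mono)
qed

section \<open>Number of moduli and size bounds\<close>

lemma bits_sum_list_le: "ws \<noteq> [] \<Longrightarrow> bits (sum_list ws) \<le> input_size ws"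
proof (induction ws rule: list_nonempty_induct)
  case (cons w ws)
  then show ?case using bits_add_le[of w "sum_list ws"] by (simp add: input_size_def)
qed (simp add: input_size_def)

lemma length_le_input_size: "length ws \<le> input_size ws"
  using sum_list_mono[of ws "\<lambda>_. 1" bits] by (simp add: input_size_def sum_list_triv Suc_le_eq)

lemma bits_nth_le_input_size: "i < length ws \<Longrightarrow> bits (ws ! i) \<le> input_size ws"
  unfolding input_size_def using elem_le_sum_list[of i "map bits ws"] by simp

text \<open>Equals \<open>2 * k\<close> for \<open>k\<close> one more than the number of halvings,
  so that \<open>k\<close> is positive even if all integers are 0.\<close>

definition num_moduli :: "nat list \<Rightarrow> nat" where
  "num_moduli ws = 2 * halvings (sum_list ws) + 2"

lemma satisfiable_num_moduli:
  "satisfiable (congruence_instance t xs (num_moduli (t # xs))) \<longleftrightarrow>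
    has_subset_sum \<lparr>target = t, items = xs\<rparr>"
  using less_two_power_halvings[of "t + sum_list xs"]
  by (intro satisfiable_congruence_instance[of _ _ "Suc (halvings (t + sum_list xs))"])
    (simp_all add: num_moduli_def)

text \<open>Prepares the choice \<open>W = 15 * Z^2\<close>, which bounds both the bit length of the
  input words and the number of cells in any private table.\<close>

lemma num_moduli_bound:
  fixes t :: nat and xs :: "nat list"
  defines "Z \<equiv> input_size (t # xs)"
  shows "num_moduli (t # xs) \<le> 2 * Z + 2" "Suc (length xs) \<le> Z"
    "2 * (Suc (length xs) * Suc (num_moduli (t # xs))) + 4 \<le> 15 * Z\<^sup>2" "Z \<le> 15 * Z\<^sup>2"
proof -
  show 1: "num_moduli (t # xs) \<le> 2 * Z + 2"
    using halvings_le_bits[of "sum_list (t # xs)"] bits_sum_list_le[of "t # xs"]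
    by (simp add: num_moduli_def Z_def)
  show 2: "Suc (length xs) \<le> Z"
    using length_le_input_size[of "t # xs"] by (simp add: Z_def)
  then have "Z \<le> Z\<^sup>2" "1 \<le> Z\<^sup>2" by (simp_all add: power2_eq_square)
  then show "Z \<le> 15 * Z\<^sup>2" by simp
  \<comment> \<open>Doubling this and adding 4 gives \<open>4 * Z^2 + 6 * Z + 4\<close>, which is at
    most \<open>14 * Z^2\<close>.\<close>
  have "Suc (length xs) * Suc (num_moduli (t # xs)) \<le> Z * (2 * Z + 3)"
    using 1 2 by (intro mult_le_mono) simp_all
  also have "\<dots> = 2 * Z\<^sup>2 + 3 * Z" by (simp add: power2_eq_square algebra_simps)
  finally show "2 * (Suc (length xs) * Suc (num_moduli (t # xs))) + 4 \<le> 15 * Z\<^sup>2"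
    using \<open>Z \<le> Z\<^sup>2\<close> \<open>1 \<le> Z\<^sup>2\<close> by linarith
qed

lemma runs_prepare:
  fixes t :: nat and xs :: "nat list"
  defines "K \<equiv> num_moduli (t # xs)" and "W \<equiv> 15 * (input_size (t # xs))\<^sup>2"
  shows "runs Q (prepare N) (init_state (t # xs)) (500 * (W * W))
    (\<lambda>u. agree_upto N (init_state (encode_sat (congruence_instance t xs K))) u \<and>
      private_ok N t xs K u)"
proof -
  define ws where "ws = t # xs"
  define n where "n = length xs"
  define L where "L = K * Suc n"
  define s0 where "s0 = init_state ws"
  define enc where "enc = encode_sat (congruence_instance t xs K)"
  note bound = num_moduli_bound[where t = t and xs = xs, folded W_def K_def n_def]
  have "K * Suc n \<le> Suc n * Suc K" by simp
  moreover have "Suc n \<le> Suc n * Suc K" "Suc K \<le> Suc n * Suc K" by simp_all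
  ultimately have W: "L + 2 \<le> W" "Suc n \<le> W" "K + 3 \<le> W" "4 \<le> W"
    unfolding L_def using bound(3) by linarith+
  have bits_W: "bits (sum_list ws) \<le> W" "bits n \<le> W" "bits (Suc n) \<le> W" "bits K \<le> W"
    using bits_sum_list_le[of ws] bound(4) bits_le_Suc[of n] bits_le_Suc[of "Suc n"] bits_le_Suc[of K] W
      bound(2,3)
    by (simp_all add: ws_def)
  have len: "length enc = 2 + L"
    by (simp add: enc_def length_encode_congruence_instance L_def n_def)
  \<comment> \<open>The encoding is at least as long as the original input, so no old word is left
    beyond its end, where \<open>init_state\<close> demands zeros.\<close>
  have "Suc n \<le> L" by (simp add: L_def K_def num_moduli_def)
  have s0: "var s0 = (\<lambda>x. if x = 0 then Suc n else 0)"
      "arr s0 = (\<lambda>a. if a = 0 then input_array ws else (\<lambda>_. 0))"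
    by (auto simp: s0_def init_state_def ws_def n_def input_array_def fun_eq_iff)
  define R1 where "R1 s \<longleftrightarrow> frame {vn N, vK N, vl N} {} s0 s \<and>
    var s (vn N) = n \<and> var s (vK N) = 2 \<and> var s (vl N) = Suc n" for s
  define R2 where "R2 s \<longleftrightarrow> frame {vn N, vK N, vl N, vS N} {aX N} s0 s \<and>
    var s (vn N) = n \<and> var s (vK N) = 2 \<and> arr s (aX N) = input_array ws \<and>
    var s (vS N) = sum_list ws" for s
  define R3 where "R3 s \<longleftrightarrow> frame {vn N, vK N, vl N, vS N} {aX N} s0 s \<and>
    var s (vn N) = n \<and> var s (vK N) = K \<and> arr s (aX N) = input_array ws" for s
  define R4 where "R4 s \<longleftrightarrow> frame {vn N, vK N, vl N, vS N} {aX N, 0} s0 s \<and>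
    var s (vn N) = n \<and> var s (vK N) = K \<and> arr s (aX N) = input_array ws \<and>
    (\<forall>i. arr s 0 i = (if 2 \<le> i \<and> i < 2 + L then enc ! i else input_array ws i))" for s
  have 1: "runs Q (prepare_start N) s0 (20 * W) R1"
  proof -
    have "wp W (prepare_start N) R1 s0"
      using bits_W W by (simp add: prepare_start_def R1_def s0 frame_def)
    from runs_wp[OF this] show ?thesis
      by (rule runs_mono) (use W in \<open>simp_all add: prepare_start_def\<close>)
  qed
  have 2: "runs Q (Countdown (vl N) (copy_input N)) s (2 + Suc n * (32 * W)) R2" if "R1 s" for s
  proof -
    have "runs Q (Countdown (vl N) (copy_input N)) s (2 + length ws * (32 * W))
      (\<lambda>s'. frame {vl N, vS N} {aX N} s s' \<and> arr s' (aX N) = input_array ws \<and>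
        var s' (vS N) = sum_list ws)"
      by (rule runs_copy_input)
        (use that bits_W in \<open>simp_all add: R1_def s0 frame_def ws_def n_def\<close>)
    then show ?thesis
      by (rule runs_mono) (use that in \<open>auto simp: R1_def R2_def frame_def ws_def n_def\<close>)
  qed
  have 3: "runs Q (While (Var (vS N)) (halve N)) s (2 + K * (20 * W)) R3" if "R2 s" for s
  proof (rule runs_mono[OF runs_halve[of s N "sum_list ws" W]])
    show "2 + halvings (sum_list ws) * (20 * W) \<le> 2 + K * (20 * W)"
      by (simp add: K_def num_moduli_def ws_def)
  qed (use that bits_W W in \<open>auto simp: R2_def R3_def frame_def K_def num_moduli_def ws_def\<close>)
  have 4: "runs Q (Assign (vl N) (Op Mul (Var (vK N)) (Op Add (Var (vn N)) (Const 1)))) s (20 * W)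
      (\<lambda>s'. R3 s' \<and> var s' (vl N) = L)" if "R3 s" for s
  proof -
    have "wp W (Assign (vl N) (Op Mul (Var (vK N)) (Op Add (Var (vn N)) (Const 1))))
      (\<lambda>s'. R3 s' \<and> var s' (vl N) = L) s"
      using that bits_W W by (simp add: R3_def L_def frame_set_var)
    from runs_wp[OF this] show ?thesis by (rule runs_mono) (use W in simp_all)
  qed
  have 5: "runs Q (Countdown (vl N) (write_scopes N)) s (2 + L * (130 * W)) R4"
    if "R3 s \<and> var s (vl N) = L" for s
    unfolding L_def n_def
    by (rule runs_mono[OF runs_write_scopes[where t = t] order.refl])
      (use that W in \<open>auto simp: R3_def R4_def frame_def s0 enc_def L_def n_def\<close>)
  have 6: "runs Q (prepare_end N) s (30 * W)
      (\<lambda>u. agree_upto N (init_state enc) u \<and> private_ok N t xs K u)" if "R4 s" for s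
  proof -
    have "enc ! 0 = n" "enc ! Suc 0 = K"
      by (simp_all add: enc_def encode_congruence_instance n_def)
    then have "input_array enc i = (if i = 0 then n else if i = Suc 0 then K
        else if 2 \<le> i \<and> i < 2 + L then enc ! i else input_array ws i)" for i
      using \<open>Suc n \<le> L\<close> len by (auto simp: input_array_def ws_def n_def)
    then have arr0: "(arr s 0)(0 := n, Suc 0 := K) = input_array enc"
      using that by (auto simp: R4_def)
    have "wp W (prepare_end N) (\<lambda>u. agree_upto N (init_state enc) u \<and> private_ok N t xs K u) s"
      using that bits_W W arr0 len
      by (auto simp: prepare_end_def R4_def L_def frame_def private_ok_def s0 init_state_def n_def
          ws_def input_array_def[of enc] fun_eq_iff)
    from runs_wp[OF this] show ?thesis
      by (rule runs_mono) (use W in \<open>simp_all add: prepare_end_def\<close>)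
  qed
  have "runs Q (prepare N) s0 (20 * W + (2 + Suc n * (32 * W) + (2 + K * (20 * W) +
      (20 * W + (2 + L * (130 * W) + 30 * W)))))
     (\<lambda>u. agree_upto N (init_state enc) u \<and> private_ok N t xs K u)"
    unfolding prepare_def
    by (rule runs_SeqI[OF 1], rule runs_SeqI[OF 2], assumption, rule runs_SeqI[OF 3], assumption,
      rule runs_SeqI[OF 4], assumption, rule runs_SeqI[OF 5], assumption, rule 6)
  moreover have "20 * W + (2 + Suc n * (32 * W) + (2 + K * (20 * W) +
      (20 * W + (2 + L * (130 * W) + 30 * W)))) \<le> 500 * (W * W)"
  proof -
    have sum_le: "20 * W + (2 + x + (2 + y + (20 * W + (2 + z + 30 * W)))) \<le> 500 * Y"
      if "x \<le> 32 * Y" "y \<le> 20 * Y" "z \<le> 130 * Y" "W \<le> Y" for x y z Y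
      using that W(4) by simp
    have "i * (k * W) \<le> k * (W * W)" if "i \<le> W" for i k
      using mult_le_mono1[OF that, of "k * W"] by (simp add: mult.left_commute)
    then show ?thesis by (rule sum_le) (use W in simp_all)
  qed
  ultimately show ?thesis unfolding s0_def ws_def enc_def by (rule runs_mono)
qed

section \<open>The reduction\<close>

theorem theorem15:
  fixes c \<epsilon> :: real
  assumes "c > 0"
    and "solvable_in_oracle_model two_edge_SAT c"
    and "\<epsilon> > 0"
  shows "solvable Subset_Sum (c + \<epsilon>)"
proof -
  obtain p C d where p: "\<forall>I\<in>sat_instances (Inv e2). \<exists>T s.
      exec (extension_oracle I) p (init_state (encode_sat I)) T s \<and>
      (accepting s \<longleftrightarrow> satisfiable I) \<and>
      real T \<le> real C * real (input_size (encode_sat I)) ^ d * 2 powr (c * real (nvars I))"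
    using assms(2)
    unfolding solvable_in_oracle_model_def decides_in_exp_time_def two_edge_SAT_def SAT_def
    by auto
  define N where "N = pmax p"
  define p' where "p' = Seq (prepare N) (translate N p)"
  \<comment> \<open>The time is at most \<open>2500 * W^2 * (1 + T)\<close>, the encoded instance
    has size at most \<open>W^2\<close>, and \<open>C + 1\<close> absorbs the added 1. Substituting
    \<open>W = 15 * Z^2\<close> in \<open>W^(2*d+2)\<close> gives the power of 15 and the exponent
    \<open>4 * d + 4\<close>.\<close>
  define C' where "C' = 2500 * (C + 1) * 15 ^ (2 * d + 2)"
  have bound: "\<exists>T s. exec Q p' (init_state (target I # items I)) T s \<and>
      (accepting s \<longleftrightarrow> has_subset_sum I) \<and>
      real T \<le> real C' * real (input_size (target I # items I)) ^ (4 * d + 4) *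
        2 powr ((c + \<epsilon>) * real (length (items I)))" for I :: subset_sum_instance and Q
  proof -
    define t xs where "t = target I" and "xs = items I"
    define K where "K = num_moduli (t # xs)"
    define Z where "Z = input_size (t # xs)"
    define W where "W = 15 * Z\<^sup>2"
    define J where "J = congruence_instance t xs K"
    define E where "E = 2 powr (c * real (length xs))"
    note bound = num_moduli_bound[where t = t and xs = xs, folded Z_def, folded W_def K_def]
    have W: "\<forall>i. bits (input_array (t # xs) i) \<le> W"
      "2 * (Suc (length xs) * Suc K) + 2 \<le> W"
      using bits_nth_le_input_size[of _ "t # xs", folded Z_def] bound
      by (auto simp: input_array_def intro: order.trans)
    obtain T s where exec: "exec (extension_oracle J) p (init_state (encode_sat J)) T s"
      and acc: "accepting s \<longleftrightarrow> satisfiable J"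
      and T: "real T \<le> real C * real (input_size (encode_sat J)) ^ d * E"
      using bspec[OF p congruence_instance_in_sat_instances[of t xs K]]
      by (auto simp: J_def E_def congruence_instance_def)
    have "runs Q p' (init_state (t # xs)) (500 * (W * W) + 2000 * (W * W) * T)
        (\<lambda>u. agree_upto N s u \<and> private_ok N t xs K u)"
      unfolding p'_def
    proof (rule runs_SeqI)
      show "runs Q (prepare N) (init_state (t # xs)) (500 * (W * W))
          (\<lambda>u. agree_upto N (init_state (encode_sat J)) u \<and> private_ok N t xs K u)"
        unfolding W_def Z_def J_def K_def by (rule runs_prepare)
    next
      fix u
      assume "agree_upto N (init_state (encode_sat J)) u \<and> private_ok N t xs K u"
      then show "runs Q (translate N p) u (2000 * (W * W) * T)
          (\<lambda>u. agree_upto N s u \<and> private_ok N t xs K u)"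
        using runs_translate[OF exec[unfolded J_def] _ _ _ W] by (simp add: N_def J_def)
    qed
    then obtain T' u where exec': "exec Q p' (init_state (t # xs)) T' u"
      and T': "T' \<le> 500 * (W * W) + 2000 * (W * W) * T" and u: "agree_upto N s u"
      unfolding runs_def by blast
    \<comment> \<open>The answer sits in variable 0, which is not private and hence the same in both
      runs.\<close>
    have "accepting u \<longleftrightarrow> accepting s"
      using u by (simp add: accepting_def frame_def)
    also have "\<dots> \<longleftrightarrow> has_subset_sum I"
      unfolding acc J_def K_def satisfiable_num_moduli by (simp add: t_def xs_def has_subset_sum_def)
    finally have accept: "accepting u \<longleftrightarrow> has_subset_sum I" .
    have "input_size (encode_sat J) \<le> (2 + K * Suc (length xs)) * (length xs + K + 1)"
      unfolding J_def by (rule input_size_encode_congruence_instance)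
    also have "\<dots> \<le> W * W"
      using bound(3) by (intro mult_le_mono) (simp_all add: algebra_simps)
    finally have "real (input_size (encode_sat J)) ^ d \<le> real (W * W) ^ d"
      by (intro power_mono) (simp_all only: of_nat_le_iff of_nat_0_le_iff)
    then have "real T \<le> real C * real (W * W) ^ d * E"
      using T by (elim order.trans) (intro mult_right_mono mult_left_mono, simp_all add: E_def)
    \<comment> \<open>Needed to absorb the cost of the preparation, which is there even when
      \<open>T\<close> is small.\<close>
    moreover have "1 \<le> real (W * W) ^ d * E"
    proof -
      have "1 \<le> W * W" using W(2) by (cases W) simp_all
      then have "1 \<le> real (W * W) ^ d" by (intro one_le_power) (metis of_nat_1 of_nat_le_iff)
      moreover have "1 \<le> E" unfolding E_def using \<open>c > 0\<close> by (intro ge_one_powr_ge_zero) simp_all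
      ultimately show ?thesis using mult_mono[of 1 _ 1] by fastforce
    qed
    ultimately have "1 + real T \<le> real (C + 1) * (real (W * W) ^ d * E)"
      by (simp add: algebra_simps)
    then have "2500 * real (W * W) * (1 + real T) \<le>
        2500 * real (W * W) * (real (C + 1) * (real (W * W) ^ d * E))"
      by (rule mult_left_mono) simp
    moreover have "real T' \<le> 2500 * real (W * W) * (1 + real T)"
    proof -
      have "T' \<le> 2500 * (W * W) * (1 + T)" using T' by (simp add: algebra_simps)
      then have "real T' \<le> real (2500 * (W * W) * (1 + T))" by (simp only: of_nat_le_iff)
      then show ?thesis by (simp add: algebra_simps)
    qed
    moreover have "2500 * real (W * W) * (real (C + 1) * (real (W * W) ^ d * E)) =
        real C' * real Z ^ (4 * d + 4) * E"
    proof -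
      have "W * W * (W * W) ^ d = W ^ (2 * d + 2)"
        by (simp add: power_add power_mult power2_eq_square)
      also have "\<dots> = 15 ^ (2 * d + 2) * Z ^ (2 * (2 * d + 2))"
        unfolding W_def power_mult_distrib power_mult ..
      also have "2 * (2 * d + 2) = 4 * d + 4" by simp
      finally have "real (W * W * (W * W) ^ d) = real (15 ^ (2 * d + 2) * Z ^ (4 * d + 4))"
        by (rule arg_cong)
      then have eq: "real (W * W) * real (W * W) ^ d = real (15 ^ (2 * d + 2) * Z ^ (4 * d + 4))"
        by (simp only: of_nat_mult of_nat_power)
      have "2500 * real (W * W) * (real (C + 1) * (real (W * W) ^ d * E)) =
          2500 * real (C + 1) * (real (W * W) * real (W * W) ^ d) * E"
        by (simp only: mult_ac)
      then show ?thesis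
        unfolding eq C'_def by (simp only: of_nat_mult of_nat_power of_nat_numeral mult_ac)
    qed
    moreover have "real C' * real Z ^ (4 * d + 4) * E \<le>
        real C' * real Z ^ (4 * d + 4) * 2 powr ((c + \<epsilon>) * real (length xs))"
      unfolding E_def using \<open>\<epsilon> > 0\<close>
      by (intro mult_left_mono powr_mono mult_right_mono) simp_all
    ultimately have "real T' \<le>
        real C' * real Z ^ (4 * d + 4) * 2 powr ((c + \<epsilon>) * real (length xs))"
      by linarith
    with exec' accept show ?thesis unfolding Z_def t_def xs_def by blast
  qed
  have "decides_in_exp_time p' Subset_Sum (c + \<epsilon>)"
    unfolding decides_in_exp_time_def Subset_Sum_def problem.simps
    by (rule exI[of _ C'], rule exI[of _ "4 * d + 4"], rule ballI, rule bound)
  moreover have "oracle_free p'"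
    by (simp add: p'_def oracle_free_prepare oracle_free_translate)
  ultimately show ?thesis unfolding solvable_def by blast
qed

end
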